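(* There is a constant $C$ such that for every integer $N \ge 2$ there exists a restricted glue tile assembly system (rgTAS) $\mathcal{T}_N = (T_N, \sigma, 1)$ with $|T_N| \le C \frac{\log N}{\log \log N}$ that is directed (has exactly one terminal assembly) and in which the square $S_N = \{0,1,\ldots,N-1\} \times \{0,1,\ldots,N-1\}$ strictly self-assembles, i.e. the unique terminal assembly $\alpha$ satisfies $\operatorname{dom}\alpha = S_N$.
   Context: Abstract Tile Assembly Model (aTAM) in $\mathbb{Z}^2$. A tile type is a unit square that can be translated but not rotated; each of its four sides $\vec u \in \{(0,1),(1,0),(0,-1),(-1,0)\}$ carries a glue, consisting of a label (color) from a fixed alphabet and an integer strength. Two tiles placed at adjacent positions $\vec a$ and $\vec a+\vec u$ interact with strength $s$ iff the glue on side $\vec u$ of the first and the glue on side $-\vec u$ of the second have the same label and the same strength $s$; otherwise they interact with strength $0$. An assembly is a partial function $\alpha:\mathbb{Z}^2 \rightharpoonup T$ ($\operatorname{dom}\alpha$ = occupied positions). A tile assembly system (TAS) is a triple $(T,\sigma,\tau)$: a finite set $T$ of tile types, a finite seed assembly $\sigma$ (here a single tile), and a temperature $\tau\in\mathbb{N}$. Growth is irreversible: starting from $\sigma$, tiles are added one at a time; a tile of type $t$ may be placed at an empty position $\vec x$ iff the sum of the interaction strengths (positive and negative) between $t$ at $\vec x$ and the tiles already present at the (up to four) neighbors of $\vec x$ is at least $\tau$; placed tiles never detach. An assembly sequence is a sequence of assemblies obtained this way; an assembly is producible if it is reachable from $\sigma$, and terminal if no tile can be added. The TAS is directed if it has exactly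 one terminal assembly. A set $X\subseteq\mathbb{Z}^2$ strictly self-assembles if every terminal assembly $\alpha$ has $\operatorname{dom}\alpha = X$. A tile set (and the TAS $(T,\sigma,1)$ using it) is glue restricted, or an rgTAS, if (1) every glue strength has absolute value $1$, (2) the glue function is diagonal: a glue interacts only with an identical glue (strength $0$ with any other glue), and (3) there is exactly one glue type of negative strength, namely strength $-1$. Logarithms are base 2.
   Formalization: The bound |T_N| ≤ C log N / log log N is claimed only for N ≥ 3, since log log 2 = 0 makes it undefined at N = 2; for N = 2 only the existence of a directed rgTAS in which S_2 strictly self-assembles is claimed. *)

theory Defs
  imports Complex_Main
begin

datatype dir = North | East | South | West

fun dvec :: "dir \<Rightarrow> int \<times> int" where
  "dvec North = (0, 1)"
| "dvec East = (1, 0)"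
| "dvec South = (0, -1)"
| "dvec West = (-1, 0)"

fun opp :: "dir \<Rightarrow> dir" where
  "opp North = South"
| "opp East = West"
| "opp South = North"
| "opp West = East"

text \<open>A glue is a label (colour, from the alphabet nat) together with an integer strength.
  A tile type assigns to each side either a glue or no glue (None, the null glue).\<close>
type_synonym glue = "nat \<times> int"
type_synonym tile = "dir \<Rightarrow> glue option"
type_synonym pos = "int \<times> int"
type_synonym assembly = "pos \<Rightarrow> tile option"

definition padd :: "pos \<Rightarrow> pos \<Rightarrow> pos" where
  "padd x v = (fst x + fst v, snd x + snd v)"

definition glue_str :: "glue option \<Rightarrow> glue option \<Rightarrow> int" where
  "glue_str g h = (case g of None \<Rightarrow> 0 | Some a \<Rightarrow> (if h = Some a then snd a else 0))"

definition bind_strength :: "assembly \<Rightarrow> pos \<Rightarrow> tile \<Rightarrow> int" where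
  "bind_strength \<alpha> x t =
     (\<Sum>d\<in>{North, East, South, West}.
        (case \<alpha> (padd x (dvec d)) of None \<Rightarrow> 0 | Some t' \<Rightarrow> glue_str (t d) (t' (opp d))))"

definition can_attach :: "tile set \<Rightarrow> int \<Rightarrow> assembly \<Rightarrow> pos \<Rightarrow> tile \<Rightarrow> bool" where
  "can_attach T \<tau> \<alpha> x t \<longleftrightarrow> t \<in> T \<and> \<alpha> x = None \<and> bind_strength \<alpha> x t \<ge> \<tau>"

definition asm_step :: "tile set \<Rightarrow> int \<Rightarrow> assembly \<Rightarrow> assembly \<Rightarrow> bool" where
  "asm_step T \<tau> \<alpha> \<beta> \<longleftrightarrow> (\<exists>x t. can_attach T \<tau> \<alpha> x t \<and> \<beta> = \<alpha>(x := Some t))"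

text \<open>Result (limit) of a possibly infinite assembly sequence; finite sequences are
  represented by eventually stuttering sequences.\<close>
definition seq_result :: "(nat \<Rightarrow> assembly) \<Rightarrow> assembly" where
  "seq_result s x = (if \<exists>i. s i x \<noteq> None then s (LEAST i. s i x \<noteq> None) x else None)"

definition producible :: "tile set \<Rightarrow> assembly \<Rightarrow> int \<Rightarrow> assembly \<Rightarrow> bool" where
  "producible T \<sigma> \<tau> \<alpha> \<longleftrightarrow>
     (\<exists>s. s 0 = \<sigma> \<and> (\<forall>i. s (Suc i) = s i \<or> asm_step T \<tau> (s i) (s (Suc i)))
          \<and> \<alpha> = seq_result s)"

definition terminal :: "tile set \<Rightarrow> int \<Rightarrow> assembly \<Rightarrow> bool" where
  "terminal T \<tau> \<alpha> \<longleftrightarrow> \<not> (\<exists>x t. can_attach T \<tau> \<alpha> x t)"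

definition directed :: "tile set \<Rightarrow> assembly \<Rightarrow> int \<Rightarrow> bool" where
  "directed T \<sigma> \<tau> \<longleftrightarrow> (\<exists>!\<alpha>. producible T \<sigma> \<tau> \<alpha> \<and> terminal T \<tau> \<alpha>)"

definition strictly_self_assembles :: "tile set \<Rightarrow> assembly \<Rightarrow> int \<Rightarrow> pos set \<Rightarrow> bool" where
  "strictly_self_assembles T \<sigma> \<tau> X \<longleftrightarrow>
     (\<forall>\<alpha>. producible T \<sigma> \<tau> \<alpha> \<and> terminal T \<tau> \<alpha> \<longrightarrow> dom \<alpha> = X)"

definition glues_of :: "tile set \<Rightarrow> glue set" where
  "glues_of T = {g. \<exists>t\<in>T. \<exists>d. t d = Some g}"

text \<open>Glue restricted tile set: finite, all glue strengths have absolute value 1,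
  exactly one glue type of negative strength. Diagonality of the glue function is
  built into glue_str.\<close>
definition rg_tileset :: "tile set \<Rightarrow> bool" where
  "rg_tileset T \<longleftrightarrow> finite T \<and> (\<forall>g\<in>glues_of T. \<bar>snd g\<bar> = 1)
     \<and> card {g \<in> glues_of T. snd g < 0} = 1"

definition square :: "nat \<Rightarrow> pos set" where
  "square N = {(i, j). 0 \<le> i \<and> i < int N \<and> 0 \<le> j \<and> j < int N}"

end

theory Submission
  imports Defs "HOL-Library.Countable"
begin

text \<open>
  The square is framed by a pinwheel of four congruent strips, each of them a base-\<open>b\<close> counter with
  \<open>k\<close> digits whose number of rows is tuned by its initial value; the last strip then opens
  a port through which the enclosed centre is filled row by row. With \<open>b\<close> about
  \<open>sqrt (log N)\<close> and \<open>k\<close> about \<open>2 log N / log log N\<close> the counters need \<open>O(b + k)\<close> tile types.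

  A counter is a single zig-zag path. When it has to read a digit of the previous pass, it steps
  into a notch with three occupied neighbours: the path (strength \<open>1\<close>), the digit (strength \<open>1\<close>)
  and a guard (strength \<open>-1\<close>). At temperature \<open>1\<close> a reading tile sticks there only if it
  matches both the path and the digit, so the negative glue simulates cooperation. The guard is placed
  before the digit, hence the exposed digit alone never attracts a tile.

  Every positive glue carries the direction in which it is emitted, so a match always
  joins an emitting to a receiving side. Apart from the centre, the tiles are therefore placed in one
  fixed order, and every producible assembly is described by a set of cells that is closed
  under predecessors.
\<close>

section \<open>Growth along predecessors\<close>

text \<open>At temperature 1 a tile sticks as soon as a single positive glue matches, so without
  repulsion no tile can combine two pieces of information, and every exposed positive glue is a
  place where growth might go wrong. Directedness is therefore reduced to a local statement:
  whatever can attach is the tile planned for that position, and its predecessor is already there.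
  The pinwheel is useful because the centre then needs no counting: its rows run until they hit the
  frame, whose relevant sides are finished before the port is placed. Tiles cannot be rotated, so
  each strip uses its own rotated copy of every label, a factor of 4 in the count. For the size of
  the counter it suffices that \<open>b ^ k\<close> is at least \<open>N\<close>: the base
  \<open>sqrt (log N)\<close> has half of \<open>log log N\<close> as its logarithm, so
  \<open>2 log N / log log N\<close> digits are enough, and the base itself is of no larger order
  than this number of digits.\<close>

definition down_closed :: "'c set \<Rightarrow> ('c \<Rightarrow> 'c) \<Rightarrow> 'c \<Rightarrow> 'c set \<Rightarrow> bool" where
  "down_closed V pred c0 A \<longleftrightarrow> A \<subseteq> V \<and> c0 \<in> A \<and> (\<forall>c\<in>A. c \<noteq> c0 \<longrightarrow> pred c \<in> A)"

text \<open>Placed tiles never change, so a finite run prolonged by stuttering has its last assembly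
  as limit.\<close>

lemma rtranclp_asm_step_producible:
  assumes "(asm_step T \<tau>)\<^sup>*\<^sup>* \<sigma> \<beta>"
  shows "producible T \<sigma> \<tau> \<beta>"
proof -
  obtain n where "(asm_step T \<tau> ^^ n) \<sigma> \<beta>"
    using assms rtranclp_imp_relpowp by metis
  then obtain f where f: "f 0 = \<sigma>" "f n = \<beta>" "\<And>i. i < n \<Longrightarrow> asm_step T \<tau> (f i) (f (Suc i))"
    using relpowp_fun_conv by metis
  define s where "s i = f (min i n)" for i
  have st: "s (Suc i) = s i \<or> asm_step T \<tau> (s i) (s (Suc i))" for i
    using f(3)[of i] by (cases "i < n") (auto simp: s_def min_def)
  have mono1: "s (Suc i) z = s i z" if "s i z \<noteq> None" for i z
    using st[of i] that by (auto simp: asm_step_def can_attach_def)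
  have mono: "s (i + m) z = s i z" if "s i z \<noteq> None" for i m z
    using that by (induction m) (auto simp: mono1)
  have "seq_result s z = \<beta> z" for z
  proof (cases "\<exists>i. s i z \<noteq> None")
    case True
    define m where "m = (LEAST i. s i z \<noteq> None)"
    have "s m z \<noteq> None" unfolding m_def using True by (metis (mono_tags, lifting) LeastI)
    hence "s (m + n) z = s m z" by (rule mono)
    moreover have "s (m + n) z = \<beta> z" by (simp add: s_def f)
    ultimately show ?thesis using True by (simp add: seq_result_def m_def)
  next
    case False
    hence "s n z = None" by blast
    thus ?thesis using False by (simp add: seq_result_def s_def f)
  qed
  hence "\<beta> = seq_result s" by auto
  moreover have "s 0 = \<sigma>" by (simp add: s_def f)
  ultimately show ?thesis using st unfolding producible_def by blast
qed

text \<open>A cell fixes a position together with the tile planned there, so an assembly is encoded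
  by its set of cells. The well-founded \<open>r\<close> makes chains of predecessors end. Both the
  counters and the comb for small squares are instances.\<close>

locale growth =
  fixes V :: "'c set" and pos :: "'c \<Rightarrow> pos" and tile_of :: "'c \<Rightarrow> tile"
    and pred :: "'c \<Rightarrow> 'c" and c0 :: 'c and T :: "tile set" and r :: "('c \<times> 'c) set"
  assumes fin: "finite V" and inj: "inj_on pos V" and c0: "c0 \<in> V"
    and wf: "wf r" and pred_less: "\<And>c. c \<in> V \<Longrightarrow> c \<noteq> c0 \<Longrightarrow> (pred c, c) \<in> r"
    and pred_V: "\<And>c. c \<in> V \<Longrightarrow> c \<noteq> c0 \<Longrightarrow> pred c \<in> V"
    and tile_of_T: "\<And>c. c \<in> V \<Longrightarrow> tile_of c \<in> T"
begin

definition asm :: "'c set \<Rightarrow> assembly" where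
  "asm A z = (if z \<in> pos ` A then Some (tile_of (inv_into V pos z)) else None)"

lemma asm_pos: "A \<subseteq> V \<Longrightarrow> c \<in> V \<Longrightarrow> asm A (pos c) = (if c \<in> A then Some (tile_of c) else None)"
  unfolding asm_def using inj by (auto simp: inj_on_def)

lemma asm_SomeD:
  assumes "A \<subseteq> V" "asm A z = Some t"
  obtains c where "c \<in> A" "z = pos c" "t = tile_of c"
  using assms asm_pos by (metis (no_types, lifting) asm_def imageE in_mono option.distinct(1) option.inject)

lemma asm_insert:
  assumes "A \<subseteq> V" "c \<in> V"
  shows "asm (insert c A) = (asm A)(pos c := Some (tile_of c))"
  using assms by (auto simp: asm_def inj)

text \<open>By \<open>attach\<close>, every step from a down-closed set leads to another one; by
  \<open>progress\<close>, a cell whose predecessor is present is never blocked. Hence growth cannot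
  leave the plan and cannot stop before all of \<open>V\<close> is placed.\<close>

lemma growth_main:
  assumes attach: "\<And>A x t. down_closed V pred c0 A \<Longrightarrow> x \<notin> pos ` A \<Longrightarrow> t \<in> T \<Longrightarrow>
      bind_strength (asm A) x t \<ge> 1 \<Longrightarrow> \<exists>c\<in>V. pos c = x \<and> tile_of c = t \<and> pred c \<in> A"
    and progress: "\<And>A c. down_closed V pred c0 A \<Longrightarrow> c \<in> V \<Longrightarrow> c \<notin> A \<Longrightarrow> pred c \<in> A \<Longrightarrow>
      bind_strength (asm A) (pos c) (tile_of c) \<ge> 1"
  shows "directed T (Map.empty(pos c0 := Some (tile_of c0))) 1"
    and "strictly_self_assembles T (Map.empty(pos c0 := Some (tile_of c0))) 1 (pos ` V)"
proof -
  let ?D = "down_closed V pred c0"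
  let ?\<sigma> = "Map.empty(pos c0 := Some (tile_of c0))"
  have seed: "?\<sigma> = asm {c0}"
    using c0 inj by (auto simp: asm_def fun_eq_iff)
  have D0: "?D {c0}" using c0 by (simp add: down_closed_def)
  have step: "\<exists>c. ?D (insert c A) \<and> \<beta> = asm (insert c A)" if D: "?D A" and st: "asm_step T 1 (asm A) \<beta>" for A \<beta>
  proof -
    obtain x t where xt: "can_attach T 1 (asm A) x t" "\<beta> = (asm A)(x := Some t)"
      using st by (auto simp: asm_step_def)
    have "x \<notin> pos ` A" using xt(1) by (auto simp: can_attach_def asm_def)
    then obtain c where c: "c \<in> V" "pos c = x" "tile_of c = t" "pred c \<in> A"
      using attach[OF D] xt(1) unfolding can_attach_def by blast
    moreover have "A \<subseteq> V" using D by (simp add: down_closed_def)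
    ultimately show ?thesis using D xt(2) asm_insert
      by (intro exI[of _ c]) (auto simp: down_closed_def)
  qed
  have canpro: "can_attach T 1 (asm A) (pos c) (tile_of c)"
    if "?D A" "c \<in> V" "c \<notin> A" "pred c \<in> A" for A c
    using progress[OF that] that tile_of_T asm_pos by (auto simp: can_attach_def down_closed_def)
  \<comment> \<open>A missing cell that is minimal for \<open>r\<close> has its predecessor in
    \<open>A\<close> and could attach, against terminality.\<close>
  have complete: "A = V" if D: "?D A" and tm: "terminal T 1 (asm A)" for A
  proof -
    have "c \<in> V \<longrightarrow> c \<in> A" for c
      using wf
    proof (induction c rule: wf_induct_rule)
      case (less c)
      show ?case
      proof (intro impI, rule ccontr)
        assume c: "c \<in> V" "c \<notin> A"
        hence "c \<noteq> c0" using D by (auto simp: down_closed_def)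
        hence "pred c \<in> A" using less c pred_less pred_V by blast
        thus False using canpro[OF D c] tm unfolding terminal_def by blast
      qed
    qed
    thus ?thesis using D by (auto simp: down_closed_def)
  qed
  have DV: "?D V" using c0 pred_V by (simp add: down_closed_def)
  have tV: "terminal T 1 (asm V)"
  proof -
    have False if "can_attach T 1 (asm V) x t" for x t
    proof -
      have "x \<notin> pos ` V" using that by (auto simp: can_attach_def asm_def)
      thus False using attach[OF DV] that unfolding can_attach_def by blast
    qed
    thus ?thesis by (auto simp: terminal_def)
  qed
  have reach: "?D A \<Longrightarrow> (asm_step T 1)\<^sup>*\<^sup>* (asm A) (asm V)" for A
  proof (induction "card (V - A)" arbitrary: A rule: less_induct)
    case less
    show ?case
    proof (cases "A = V")
      case False
      then obtain x t where xt: "can_attach T 1 (asm A) x t"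
        using complete[OF less.prems] by (auto simp: terminal_def)
      let ?\<beta> = "(asm A)(x := Some t)"
      have st: "asm_step T 1 (asm A) ?\<beta>" using xt unfolding asm_step_def by blast
      obtain c where c: "?D (insert c A)" "?\<beta> = asm (insert c A)" using step[OF less.prems st] by blast
      have "c \<notin> A"
      proof
        assume "c \<in> A"
        hence "?\<beta> = asm A" using c(2) by (simp add: insert_absorb)
        hence "asm A x = Some t" by (metis fun_upd_same)
        thus False using xt by (simp add: can_attach_def)
      qed
      moreover have "c \<in> V" using c(1) by (simp add: down_closed_def)
      ultimately have "card (V - insert c A) < card (V - A)"
        using fin by (intro psubset_card_mono) auto
      from less.hyps[OF this c(1)] st c(2) show ?thesis
        by (metis converse_rtranclp_into_rtranclp)
    qed simp
  qed
  have prodV: "producible T ?\<sigma> 1 (asm V)"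
    using rtranclp_asm_step_producible[OF reach[OF D0]] seed by simp
  have uniq: "\<alpha> = asm V" if pr: "producible T ?\<sigma> 1 \<alpha>" and tm: "terminal T 1 \<alpha>" for \<alpha>
  proof -
    obtain s where s: "s 0 = ?\<sigma>" "\<And>i. s (Suc i) = s i \<or> asm_step T 1 (s i) (s (Suc i))"
      "\<alpha> = seq_result s" using pr by (auto simp: producible_def)
    \<comment> \<open>An assembly sequence may be infinite. Its stages are turned back into sets of
      cells, and the limit is the assembly of their union, which is again down-closed.\<close>
    define B where "B i = {c \<in> V. s i (pos c) \<noteq> None}" for i
    have asmB: "{c \<in> V. asm A (pos c) \<noteq> None} = A" if "A \<subseteq> V" for A
      using that asm_pos[OF that] by (auto split: if_splits)
    have inv: "\<exists>A. ?D A \<and> s i = asm A" for i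
    proof (induction i)
      case 0 thus ?case using D0 seed s(1) by auto
    next
      case (Suc i)
      then obtain A where A: "?D A" "s i = asm A" by blast
      thus ?case using s(2)[of i] step[OF A(1)] by metis
    qed
    have B: "?D (B i)" "s i = asm (B i)" for i
    proof -
      obtain A where A: "?D A" "s i = asm A" using inv by blast
      hence "B i = A" using asmB[of A] by (simp add: B_def down_closed_def)
      thus "?D (B i)" "s i = asm (B i)" using A by auto
    qed
    define U where "U = (\<Union>i. B i)"
    have DU: "?D U" using B(1) unfolding U_def down_closed_def by blast
    have BV: "B i \<subseteq> V" for i by (auto simp: B_def)
    have UV: "U \<subseteq> V" using BV by (auto simp: U_def)
    have "seq_result s z = asm U z" for z
    proof (cases "\<exists>i. s i z \<noteq> None")
      case True
      define m where "m = (LEAST i. s i z \<noteq> None)"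
      have "s m z \<noteq> None" unfolding m_def using True by (metis (mono_tags, lifting) LeastI)
      then obtain t where t: "asm (B m) z = Some t" using B(2) by auto
      then obtain c where c: "c \<in> B m" "z = pos c" "t = tile_of c" using asm_SomeD[OF BV] by metis
      have "c \<in> U" using c(1) by (auto simp: U_def)
      hence "asm U z = Some t" using c UV asm_pos[OF UV, of c] by auto
      thus ?thesis using True t B(2)[of m] by (simp add: seq_result_def m_def)
    next
      case False
      have "asm U z = None"
      proof (rule ccontr)
        assume "asm U z \<noteq> None"
        then obtain t where "asm U z = Some t" by blast
        then obtain c where c: "c \<in> U" "z = pos c" by (rule asm_SomeD[OF UV])
        then obtain i where "c \<in> B i" by (auto simp: U_def)
        thus False using False c by (auto simp: B_def)
      qed
      thus ?thesis using False by (simp add: seq_result_def)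
    qed
    hence "\<alpha> = asm U" using s(3) by auto
    thus ?thesis using complete[OF DU] tm by simp
  qed
  show "directed T ?\<sigma> 1" unfolding directed_def using prodV tV uniq by blast
  have "dom (asm V) = pos ` V" by (auto simp: asm_def dom_def split: if_splits)
  thus "strictly_self_assembles T ?\<sigma> 1 (pos ` V)"
    unfolding strictly_self_assembles_def using uniq by auto
qed

end

section \<open>Tiles of the counter strips\<close>

instance dir :: countable by countable_datatype

text \<open>
  \<open>Inc c\<close> is an eastward pass adding the carry \<open>c\<close>, \<open>Copy\<close> a westward pass, \<open>Fin\<close> the last
  (westward) pass. The two flags of a digit mark the first and the last column. A label \<open>Seed u v\<close>
  belongs to the hard-coded first pass; in the later passes a segment consists of the six cells
  \<open>Seg 0\<close>, ..., \<open>Seg 5\<close> (\<open>Seg 2\<close> exposes the new digit backwards), the guard and the reader.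
  \<open>Riser\<close> and \<open>Filler\<close> fill the centre. A \<open>key\<close> is the part of the label of the next
  tile that its predecessor knows: a reader is announced without its digit.
\<close>

datatype mode = Inc bool | Copy | Fin
type_synonym digit = "nat \<times> bool \<times> bool"
datatype lab = Seed nat nat | Seg nat mode "digit option" | Guard mode | Reader mode digit | Riser | Filler
datatype key = KLab lab | KRead mode | KDigit digit
text \<open>\<open>Pos d i \<kappa>\<close>: direction of emission (in the global frame), strip, and content.\<close>
datatype sglue = Neg | Pos dir nat key

instance mode :: countable by countable_datatype
instance lab :: countable by countable_datatype
instance key :: countable by countable_datatype

text \<open>An encoded positive glue may also receive the number 0; the strength still separates it
  from the negative glue.\<close>

fun enc :: "sglue \<Rightarrow> glue" where
  "enc Neg = (0, -1)"
| "enc (Pos d i \<kappa>) = (to_nat (d, i, \<kappa>), 1)"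

lemma enc_inj: "enc g = enc h \<longleftrightarrow> g = h"
  by (cases g; cases h) auto

fun turn_cw :: "dir \<Rightarrow> dir" where
  "turn_cw North = East" | "turn_cw East = South" | "turn_cw South = West" | "turn_cw West = North"

definition rot :: "nat \<Rightarrow> dir \<Rightarrow> dir" where "rot i = turn_cw ^^ i"
definition unrot :: "nat \<Rightarrow> dir \<Rightarrow> dir" where "unrot i = turn_cw ^^ (4 - i)"

lemma less4: "(i::nat) < 4 \<longleftrightarrow> i = 0 \<or> i = 1 \<or> i = 2 \<or> i = 3" by auto

lemma less8: "(e::nat) < 8 \<longleftrightarrow> e = 0 \<or> e = 1 \<or> e = 2 \<or> e = 3 \<or> e = 4 \<or> e = 5 \<or> e = 6 \<or> e = 7" by auto

lemma turn_cw_4: "(turn_cw ^^ 4) d = d" by (cases d) (auto simp: numeral_eq_Suc)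

lemma rot_unrot: "i < 4 \<Longrightarrow> rot i (unrot i d) = d"
  unfolding rot_def unrot_def using funpow_add[of i "4 - i" turn_cw] turn_cw_4 by (simp add: fun_eq_iff)

lemma unrot_rot: "i < 4 \<Longrightarrow> unrot i (rot i d) = d"
  unfolding rot_def unrot_def using funpow_add[of "4 - i" i turn_cw] turn_cw_4 by (simp add: fun_eq_iff)

lemma rot_opp: "rot i (opp d) = opp (rot i d)"
proof -
  have "turn_cw (opp d) = opp (turn_cw d)" for d by (cases d) auto
  thus ?thesis unfolding rot_def by (induction i) auto
qed

lemma opp_opp: "opp (opp d) = d" by (cases d) auto
lemma opp_neq: "opp d \<noteq> d" "d \<noteq> opp d" by (cases d; simp)+

lemma rot_simps:
  "rot 0 d = d" "rot 1 d = turn_cw d" "rot (Suc 0) d = turn_cw d" "rot 2 d = turn_cw (turn_cw d)"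
  "rot 3 d = turn_cw (turn_cw (turn_cw d))"
  by (auto simp: rot_def numeral_eq_Suc)

text \<open>The last pass of a strip is left northwards; seen from the next strip this is the
  westward entry into \<open>Seed 0 0\<close>.\<close>

lemma rot_Suc_West: "rot (Suc i) West = rot i North"
  by (simp add: rot_def funpow_Suc_right del: funpow.simps)

fun heading :: "mode \<Rightarrow> dir" where
  "heading (Inc _) = East" | "heading Copy = West" | "heading Fin = West"

fun in_key :: "lab \<Rightarrow> key" where
  "in_key (Reader m D) = KRead m" | "in_key l = KLab l"

text \<open>The direction of travel on entering the cell; the receiving side is the opposite one. A
  \<open>Seg 0\<close> without digit starts a pass and is entered from below. In the last pass
  \<open>Seg 4\<close> follows \<open>Seg 1\<close> directly, hence horizontally.\<close>

fun in_dir :: "lab \<Rightarrow> dir" where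
  "in_dir (Seed u v) = (if v = 0 then West else if even u then North else South)"
| "in_dir (Seg e m Do) = (if e = 0 then (if Do = None then North else heading m)
     else if e \<le> 2 then North
     else if e = 4 \<and> m \<noteq> Fin then South else heading m)"
| "in_dir (Guard m) = heading m"
| "in_dir (Reader m D) = South"
| "in_dir Riser = North"
| "in_dir Filler = East"

definition receives :: "lab \<Rightarrow> dir \<Rightarrow> key option" where
  "receives l d = (if d = opp (in_dir l) then Some (in_key l)
     else case l of Reader m D \<Rightarrow> if d = opp (heading m) then Some (KDigit D) else None | _ \<Rightarrow> None)"

text \<open>These are the sides on which a guard and the reader above it touch. Seed columns
  congruent to 3 modulo 4 run downwards, so index 0 is their top. Nothing is read above the last
  pass, so its guards do not repel.\<close>

fun neg_side :: "lab \<Rightarrow> dir \<Rightarrow> bool" where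
  "neg_side (Seed u v) d \<longleftrightarrow> d = North \<and> u mod 4 = 3 \<and> v = 0"
| "neg_side (Guard m) d \<longleftrightarrow> d = North \<and> m \<noteq> Fin"
| "neg_side (Reader m D) d \<longleftrightarrow> d = South"
| "neg_side _ d \<longleftrightarrow> False"

fun last_seg :: "mode \<Rightarrow> digit option \<Rightarrow> bool" where
  "last_seg m None \<longleftrightarrow> False"
| "last_seg m (Some (d, z0, z1)) \<longleftrightarrow> (if heading m = East then z1 else z0)"

text \<open>A carry leaving the most significant digit signals overflow, and this is what announces
  the final pass.\<close>

fun turn :: "nat \<Rightarrow> mode \<Rightarrow> (nat \<times> key) option" where
  "turn i (Inc c) = Some (i, KLab (Seg 0 (if c then Fin else Copy) None))"
| "turn i Copy = Some (i, KLab (Seg 0 (Inc True) None))"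
| "turn i Fin = (if i < 3 then Some (i + 1, KLab (Seed 0 0)) else None)"

type_synonym cell = "nat \<times> nat \<times> nat \<times> nat"

text \<open>
  A cell \<open>(i, p, s, e)\<close> is position \<open>e\<close> of segment \<open>s\<close> of pass \<open>p\<close> of strip \<open>i\<close>; in pass \<open>0\<close>,
  \<open>s\<close> is a column and \<open>e\<close> an index along it. The cell of the centre at \<open>(x, y)\<close> is \<open>(4, 0, x, y)\<close>.
\<close>

fun cell_less :: "cell \<Rightarrow> cell \<Rightarrow> bool" where
  "cell_less (i, p, s, e) (i', p', s', e') \<longleftrightarrow>
     i < i' \<or> i = i' \<and> (p < p' \<or> p = p' \<and> (s < s' \<or> s = s' \<and> e < e'))"

lemma wf_cell_less: "wf {(c, d). cell_less c d}"
proof -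
  have "{(c, d). cell_less c d} = less_than <*lex*> less_than <*lex*> less_than <*lex*> less_than" by auto
  thus ?thesis by (metis wf_less_than wf_lex_prod)
qed

section \<open>Residues modulo 4 and the carry of an increment\<close>

lemma mod4_cases:
  fixes u :: nat
  obtains a where "u = 4 * a" | a where "u = 4 * a + 1" | a where "u = 4 * a + 2" | a where "u = 4 * a + 3"
proof -
  have "u = 4 * (u div 4) + u mod 4" by simp
  moreover have "u mod 4 = 0 \<or> u mod 4 = 1 \<or> u mod 4 = 2 \<or> u mod 4 = 3" by arith
  ultimately show ?thesis using that by (metis add.right_neutral)
qed

text \<open>The carry reaches column \<open>c\<close> exactly when all lower digits wrap to 0, that
  is, when \<open>b ^ c\<close> divides the successor; it also leaves the column when
  \<open>b ^ Suc c\<close> does.\<close>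

lemma digit_Suc:
  fixes b v c :: nat
  assumes b: "2 \<le> b"
  shows "if b ^ c dvd Suc v then
      (if b ^ Suc c dvd Suc v then v div b ^ c mod b = b - 1 \<and> Suc v div b ^ c mod b = 0
       else v div b ^ c mod b + 1 < b \<and> Suc v div b ^ c mod b = v div b ^ c mod b + 1)
    else \<not> b ^ Suc c dvd Suc v \<and> Suc v div b ^ c mod b = v div b ^ c mod b"
proof (cases "b ^ c dvd Suc v")
  case True
  have B: "b ^ c > 0" using b by simp
  obtain q where q: "Suc v = b ^ c * q" using True by (auto elim: dvdE)
  obtain q' where q': "q = Suc q'" using q by (cases q) auto
  have "b ^ c * q' \<le> v" using q q' B by (cases "b ^ c") auto
  moreover have "v < b ^ c * Suc q'" using q q' by simp
  ultimately have vd: "v div b ^ c = q'" by (rule div_nat_eqI)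
  have sd: "Suc v div b ^ c = q" using q B by simp
  have dv: "b ^ Suc c dvd Suc v \<longleftrightarrow> b dvd q" using q B by (simp add: mult.commute)
  show ?thesis
  proof (cases "b dvd q")
    case t: True
    hence "Suc q' mod b = 0" using q' by (simp add: dvd_eq_mod_eq_0)
    hence "q' mod b = b - 1" by (auto simp: mod_Suc split: if_splits)
    thus ?thesis using True dv t vd sd by (simp add: dvd_eq_mod_eq_0)
  next
    case f: False
    hence "Suc (q' mod b) \<noteq> b" using q' by (auto simp: mod_Suc dvd_eq_mod_eq_0)
    moreover have "q' mod b < b" using b by simp
    ultimately show ?thesis using True dv f vd sd q' by (simp add: mod_Suc)
  qed
next
  case False
  hence "\<not> b ^ Suc c dvd Suc v" by (metis dvd_mult_left power_Suc2)
  moreover have "Suc v div b ^ c = v div b ^ c" using False by (simp add: div_Suc dvd_eq_mod_eq_0)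
  ultimately show ?thesis using False by simp
qed

text \<open>
  A strip occupies \<open>W \<times> M\<close> positions of the square of side \<open>N = M + W\<close>. The counter starts at
  \<open>b ^ k - R\<close> and overflows after \<open>R\<close> increments. The \<open>H\<close> rows of the first
  pass adjust \<open>N\<close> modulo \<open>4\<close>.
\<close>

locale strips =
  fixes b k R H :: nat
  assumes b: "2 \<le> b" and k: "1 \<le> k" and R: "k + 1 \<le> R" and Rb: "R \<le> b ^ k" and H: "1 \<le> H"
begin

text \<open>There are \<open>k\<close> segments of width 4 and a last one of width 3, which has
  neither guard nor reader.\<close>

definition W where "W = 4 * k + 3"
definition Q where "Q = 2 * R"
definition M where "M = H + 4 * R"
definition N where "N = M + W"

text \<open>Only odd passes increment, so pass \<open>2 * R - 1\<close> is the one that reaches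
  \<open>b ^ k\<close>; the final pass \<open>Q\<close> follows it.\<close>

definition counter :: "nat \<Rightarrow> nat" where "counter p = b ^ k - R + (p + 1) div 2"
definition digit_at :: "nat \<Rightarrow> nat \<Rightarrow> digit" where
  "digit_at p c = (counter p div b ^ c mod b, c = 0, c = k - 1)"
text \<open>Column 0 is the westernmost: an eastward pass meets the least significant digit first,
  as a carry requires, and a westward pass meets the digits in reverse. Segment 0 holds no digit,
  which causes the shift by one.\<close>

definition column :: "nat \<Rightarrow> nat \<Rightarrow> nat" where "column p s = (if odd p then s - 1 else k - s)"
text \<open>The divisibility is the carry on entering column \<open>s\<close>, stated through the
  new value of the counter.\<close>

definition mode_at :: "nat \<Rightarrow> nat \<Rightarrow> mode" where
  "mode_at p s = (if odd p then Inc (b ^ s dvd counter p) else if p = Q then Fin else Copy)"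
definition digit_opt :: "nat \<Rightarrow> nat \<Rightarrow> digit option" where
  "digit_opt p s = (if s = 0 then None else Some (digit_at p (column p s)))"
text \<open>The raised columns are the bumps that fill the notches of pass 1, in the role that
  \<open>Seg 2\<close> and \<open>Seg 3\<close> play for later passes.\<close>

definition seed_height :: "nat \<Rightarrow> nat" where "seed_height u = (if u mod 4 \<le> 1 then H + 1 else H)"

fun step :: "mode \<Rightarrow> digit \<Rightarrow> mode \<times> digit" where
  "step (Inc c) (d, z) = (if c then (if d + 1 < b then (Inc False, d + 1, z) else (Inc True, 0, z))
     else (Inc False, d, z))"
| "step m D = (m, D)"

text \<open>Only the last pass of strip 3 opens the port to the centre.\<close>
fun emits :: "nat \<Rightarrow> lab \<Rightarrow> dir \<Rightarrow> (nat \<times> key) option" where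
  "emits i (Seed u v) d =
     (if v + 1 < seed_height u then (if d = (if even u then North else South) then Some (i, KLab (Seed u (v + 1)))
        else None)
      else if u + 1 < W \<and> d = West then Some (i, KLab (Seed (u + 1) 0))
      else if u + 1 = W \<and> d = North then Some (i, KLab (Seg 0 (Inc True) None))
      else if d = East \<and> u mod 4 = 0 \<and> u > 0 then Some (i, KDigit (digit_at 0 (k - u div 4))) else None)"
| "emits i (Seg e m Do) d =
     (if e = 0 then (if d = North then Some (i, KLab (Seg 1 m Do)) else None)
      else if e = 1 then
        (if m \<noteq> Fin \<and> d = North then Some (i, KLab (Seg 2 m Do))
         else if m = Fin \<and> d = West then Some (i, KLab (Seg 4 m Do))
         else if m = Fin \<and> d = East \<and> Do = None \<and> i = 3 then Some (0, KLab Riser) else None)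
      else if e = 2 then
        (if d = heading m then Some (i, KLab (Seg 3 m Do))
         else if d = opp (heading m) \<and> Do \<noteq> None then Some (i, KDigit (the Do)) else None)
      else if e = 3 then (if d = South then Some (i, KLab (Seg 4 m Do)) else None)
      else if e = 4 then (if d = heading m then Some (i, KLab (Seg 5 m Do)) else None)
      else if e = 5 then
        (if last_seg m Do then (if d = North then turn i m else None)
         else if d = heading m then Some (i, KLab (Guard m)) else None)
      else None)"
| "emits i (Guard m) d = (if d = South then Some (i, KRead m) else None)"
| "emits i (Reader m D) d = (if d = heading m then Some (i, KLab (Seg 0 (fst (step m D)) (Some (snd (step m D))))) else None)"
| "emits i Riser d = (if d = North then Some (0, KLab Riser) else if d = East then Some (0, KLab Filler) else None)"
| "emits i Filler d = (if d = East then Some (0, KLab Filler) else None)"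

text \<open>\<open>D\<close> is a global direction. An incoming glue is stamped with its direction
  of travel \<open>opp D\<close>, so it matches only the side that emits it. The order of the cases
  does no harm: for labels in \<open>labs\<close> no side has two of these uses.\<close>

definition side :: "nat \<Rightarrow> lab \<Rightarrow> dir \<Rightarrow> sglue option" where
  "side i l D = (case receives l (unrot i D) of Some \<kappa> \<Rightarrow> Some (Pos (opp D) i \<kappa>)
     | None \<Rightarrow> (case emits i l (unrot i D) of Some (j, \<kappa>) \<Rightarrow> Some (Pos D j \<kappa>)
       | None \<Rightarrow> if neg_side l (unrot i D) then Some Neg else None))"

fun strip_of :: "cell \<Rightarrow> nat" where "strip_of (i, p, s, e) = (if i < 4 then i else 0)"

fun label_of :: "cell \<Rightarrow> lab" where
  "label_of (i, p, s, e) = (if i \<ge> 4 then (if s = W then Riser else Filler)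
     else if p = 0 then Seed s e
     else if e \<le> 5 then Seg e (mode_at p s) (digit_opt p s)
     else if e = 6 then Guard (mode_at p s)
     else Reader (mode_at p s) (digit_at (p - 1) (column p (s + 1))))"

definition V :: "cell set" where
  "V = {(i, p, s, e). i < 4 \<and> p = 0 \<and> s < W \<and> e < seed_height s}
     \<union> {(i, p, s, e). i < 4 \<and> 1 \<le> p \<and> p \<le> Q \<and> s \<le> k \<and> e < 8 \<and>
          (s = k \<longrightarrow> e \<le> 5) \<and> (p = Q \<longrightarrow> e \<noteq> 2 \<and> e \<noteq> 3)}
     \<union> {(i, p, s, e). i = 4 \<and> p = 0 \<and> W \<le> s \<and> s < M \<and> W \<le> e \<and> e < M}"

fun pred_cell :: "cell \<Rightarrow> cell" where
  "pred_cell (i, p, s, e) =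
    (if i \<ge> 4 then (if s > W then (i, p, s - 1, e) else if e > W then (i, p, s, e - 1) else (3, Q, 0, 1))
     else if e > 0 then (if p = Q \<and> e = 4 then (i, p, s, 1) else (i, p, s, e - 1))
     else if s > 0 then (if p = 0 then (i, p, s - 1, seed_height (s - 1) - 1) else (i, p, s - 1, 7))
     else if p > 1 then (i, p - 1, k, 5)
     else if p = 1 then (i, 0, W - 1, seed_height (W - 1) - 1)
     else if i > 0 then (i - 1, Q, k, 5)
     else (i, p, s, e))"

definition c0 :: cell where "c0 = (0, 0, 0, 0)"

text \<open>
  Offsets of the cells of a segment: \<open>u\<close> is measured in the direction of the pass and \<open>h\<close> upwards.
  The path is \<open>(0,0), (0,1), (0,2), (1,2), (1,1), (2,1), (3,1), (3,0)\<close>, and the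
  bumps at height 2 interlock with the notches of the next pass; the last pass skips them.
\<close>

definition seg_u :: "nat \<Rightarrow> int" where "seg_u e = (if e \<le> 2 then 0 else if e \<le> 4 then 1 else if e = 5 then 2 else 3)"
definition seg_h :: "nat \<Rightarrow> int" where "seg_h e = (if e = 0 \<or> e = 7 then 0 else if e = 2 \<or> e = 3 then 2 else 1)"
definition local_x :: "nat \<Rightarrow> int \<Rightarrow> int" where "local_x p u = (if odd p then u else int W - 1 - u)"

definition local_pos :: "nat \<Rightarrow> nat \<Rightarrow> nat \<Rightarrow> pos" where
  "local_pos p s e = (if p = 0 then (local_x 0 (int s), if even s then int e else int (seed_height s) - 1 - int e)
     else (local_x p (4 * int s + seg_u e), int H + 2 * (int p - 1) + seg_h e))"

definition rot_pos :: "nat \<Rightarrow> pos \<Rightarrow> pos" where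
  "rot_pos i z = (case z of (x, y) \<Rightarrow> if i = 0 then (x, y) else if i = 1 then (y, int N - 1 - x)
     else if i = 2 then (int N - 1 - x, int N - 1 - y) else (int N - 1 - y, x))"

fun cell_pos :: "cell \<Rightarrow> pos" where
  "cell_pos (i, p, s, e) = (if i < 4 then rot_pos i (local_pos p s e) else (int s, int e))"

lemma rot_pos_padd: "i < 4 \<Longrightarrow> rot_pos i (padd z (dvec d)) = padd (rot_pos i z) (dvec (rot i d))"
  by (cases z; cases d) (auto simp: less4 rot_pos_def padd_def rot_simps)

lemma W_mod: "(W - Suc 0) mod 4 = 2" "W - Suc 0 = 4 * k + 2" "even (W - Suc 0)" by (auto simp: W_def mod_Suc)

lemma seed_height_pos: "seed_height u > 0" using H by (auto simp: seed_height_def)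

section \<open>The value of the counter and the correctness of its local rule\<close>

lemma counter_pos: "p \<ge> 1 \<Longrightarrow> counter p > 0" by (auto simp: counter_def)

lemma counter_le: "p \<le> Q \<Longrightarrow> counter p \<le> b ^ k" using Rb by (auto simp: counter_def Q_def)

text \<open>The counter stays between 1 and \<open>b ^ k\<close>, so \<open>b ^ k\<close> divides it
  only on reaching \<open>b ^ k\<close> itself.\<close>

lemma counter_overflow: "p \<le> Q \<Longrightarrow> odd p \<Longrightarrow> b ^ k dvd counter p \<longleftrightarrow> p = Q - 1"
proof -
  assume p: "p \<le> Q" "odd p"
  have "counter p > 0" using counter_pos p by (cases p) auto
  hence "b ^ k dvd counter p \<longleftrightarrow> counter p = b ^ k" using counter_le[OF p(1)] by (auto dest: dvd_imp_le)
  also have "\<dots> \<longleftrightarrow> (p + 1) div 2 = R" using Rb by (auto simp: counter_def)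
  also have "\<dots> \<longleftrightarrow> p = Q - 1" using p R unfolding Q_def by presburger
  finally show ?thesis .
qed

text \<open>A reader knows only the incoming mode and one old digit. This ties its local rule to the
  closed formulas: an odd pass shows the successor of the previous value, so
  \<open>digit_Suc\<close> applies, and an even pass shows the same value again.\<close>

lemma step_mode_at:
  assumes "1 \<le> p" "p \<le> Q" "s < k"
  shows "step (mode_at p s) (digit_at (p - 1) (column p (Suc s))) = (mode_at p (Suc s), digit_at p (column p (Suc s)))"
proof (cases "odd p")
  case True
  then obtain q where q: "p = 2 * q + 1" by (auto elim: oddE)
  define y where "y = counter (p - Suc 0)"
  have v: "counter p = Suc y" by (simp add: y_def counter_def q)
  show ?thesis using digit_Suc[OF b, of s y] True b v
    by (simp add: mode_at_def digit_at_def column_def y_def[symmetric] del: power_Suc split: if_splits)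
next
  case False
  then obtain q where q: "p = 2 * q" "q \<ge> 1" using assms by (auto elim!: evenE)
  have "counter p = counter (p - 1)" using q(2) by (cases q) (auto simp: counter_def q)
  thus ?thesis using False by (auto simp: mode_at_def digit_at_def)
qed

lemma heading_mode_at: "heading (mode_at p s) = (if odd p then East else West)" by (auto simp: mode_at_def)

lemma mode_at_Fin: "mode_at p s = Fin \<longleftrightarrow> p = Q" by (auto simp: mode_at_def Q_def)

lemma last_seg_iff: "s \<le> k \<Longrightarrow> last_seg (mode_at p s) (digit_opt p s) \<longleftrightarrow> s = k"
  using k by (auto simp: digit_opt_def digit_at_def column_def heading_mode_at)

lemma seed_height_simps:
  "seed_height (4 * a) = H + 1" "seed_height (4 * a + 1) = H + 1" "seed_height (Suc (4 * a)) = H + 1"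
  "seed_height (4 * a + 2) = H" "seed_height (Suc (Suc (4 * a))) = H" "seed_height (4 * a + 3) = H" "seed_height (Suc (Suc (Suc (4 * a)))) = H"
  by (auto simp: seed_height_def mod_Suc)

lemma seed_height_odd: "odd u \<Longrightarrow> seed_height (u - Suc 0) = seed_height u"
  by (cases u rule: mod4_cases) (auto simp: seed_height_simps)

lemma V_cases:
  assumes "c \<in> V"
  obtains (Seed) i u v where "c = (i, 0, u, v)" "i < 4" "u < W" "v < seed_height u"
  | (Pass) i p s e where "c = (i, p, s, e)" "i < 4" "1 \<le> p" "p \<le> Q" "s \<le> k" "e < 8" "s = k \<longrightarrow> e \<le> 5"
      "p = Q \<longrightarrow> e \<noteq> 2 \<and> e \<noteq> 3"
  | (Centre) x y where "c = (4, 0, x, y)" "W \<le> x" "x < M" "W \<le> y" "y < M"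
  using assms unfolding V_def by auto

lemma Seed_in_V:
  "(i, 0, u, v) \<in> V \<longleftrightarrow> (i < 4 \<and> u < W \<and> v < seed_height u) \<or>
     (i = 4 \<and> W \<le> u \<and> u < M \<and> W \<le> v \<and> v < M)"
  by (auto simp: V_def)

lemma Pass_in_V:
  "1 \<le> p \<Longrightarrow> (i, p, s, e) \<in> V \<longleftrightarrow>
     i < 4 \<and> p \<le> Q \<and> s \<le> k \<and> e < 8 \<and> (s = k \<longrightarrow> e \<le> 5) \<and> (p = Q \<longrightarrow> e \<noteq> 2 \<and> e \<noteq> 3)"
  by (auto simp: V_def)

section \<open>The path\<close>

text \<open>Directions are compared in the global frame because the two cells may belong to
  different strips.\<close>

definition link :: "cell \<Rightarrow> cell \<Rightarrow> bool" where
  "link c' c \<longleftrightarrow> c' \<in> V \<and> cell_less c' c \<and>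
     (\<exists>d. rot (strip_of c') d = rot (strip_of c) (in_dir (label_of c)) \<and>
          emits (strip_of c') (label_of c') d = Some (strip_of c, in_key (label_of c))) \<and>
     cell_pos c = padd (cell_pos c') (dvec (rot (strip_of c) (in_dir (label_of c))))"

lemma link_local:
  assumes "i < 4" "(i, p', s', e') \<in> V" "cell_less (i, p', s', e') (i, p, s, e)"
    "emits i (label_of (i, p', s', e')) (in_dir (label_of (i, p, s, e))) = Some (i, in_key (label_of (i, p, s, e)))"
    "local_pos p s e = padd (local_pos p' s' e') (dvec (in_dir (label_of (i, p, s, e))))"
  shows "link (i, p', s', e') (i, p, s, e)"
  using assms rot_pos_padd[of i "local_pos p' s' e'"] unfolding link_def
  by (auto simp del: label_of.simps cell_less.simps emits.simps in_dir.simps)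

lemma local_pos_Pass: "1 \<le> p \<Longrightarrow> local_pos p s e = (local_x p (4 * int s + seg_u e), int H + 2 * (int p - 1) + seg_h e)"
  by (simp add: local_pos_def)

lemma link_Pass:
  assumes "i < 4" "1 \<le> p" "p \<le> Q" "s \<le> k" "e < 8" "s = k \<longrightarrow> e \<le> 5" "p = Q \<longrightarrow> e \<noteq> 2 \<and> e \<noteq> 3" "e > 0"
  shows "link (pred_cell (i, p, s, e)) (i, p, s, e)"
proof -
  have "even Q" by (simp add: Q_def)
  note sm = Pass_in_V heading_mode_at mode_at_Fin local_pos_Pass local_x_def padd_def seg_u_def seg_h_def last_seg_iff
  consider "p = Q \<and> e = 4" | "e = 1" | "e = 2" | "e = 3" | "e = 4" "p \<noteq> Q" | "e = 5" | "e = 6" | "e = 7"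
    using assms(5,8) unfolding less8 by fastforce
  then show ?thesis
  proof cases
    case 1
    have "link (i, p, s, 1) (i, p, s, e)" using assms 1 \<open>even Q\<close> by (intro link_local) (auto simp: sm)
    thus ?thesis using 1 assms(1) by simp
  next
    case 2
    hence "link (i, p, s, 0) (i, p, s, e)" using assms by (intro link_local) (auto simp: sm)
    thus ?thesis using 2 assms(1) by simp
  next
    case 3
    hence "link (i, p, s, 1) (i, p, s, e)" using assms by (intro link_local) (auto simp: sm)
    thus ?thesis using 3 assms(1) by simp
  next
    case 4
    hence "link (i, p, s, 2) (i, p, s, e)" using assms by (intro link_local) (auto simp: sm)
    thus ?thesis using 4 assms(1) by simp
  next
    case 5
    hence "link (i, p, s, 3) (i, p, s, e)" using assms by (intro link_local) (auto simp: sm)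
    thus ?thesis using 5 assms(1) by simp
  next
    case 6
    hence "link (i, p, s, 4) (i, p, s, e)" using assms by (intro link_local) (auto simp: sm)
    thus ?thesis using 6 assms(1) by simp
  next
    case 7
    hence "link (i, p, s, 5) (i, p, s, e)" using assms by (intro link_local) (auto simp: sm)
    thus ?thesis using 7 assms(1) by simp
  next
    case 8
    hence "link (i, p, s, 6) (i, p, s, e)" using assms by (intro link_local) (auto simp: sm)
    thus ?thesis using 8 assms(1) by simp
  qed
qed

lemma link_exit:
  assumes "i < 4" "1 \<le> p" "p \<le> Q" "s \<le> k" "0 < s"
  shows "link (pred_cell (i, p, s, 0)) (i, p, s, 0)"
proof -
  obtain s' where s': "s = Suc s'" using assms by (cases s) auto
  have "link (i, p, s', 7) (i, p, s, 0)"
    using assms step_mode_at[of p s'] s'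
    by (intro link_local) (auto simp: Pass_in_V heading_mode_at mode_at_Fin local_pos_Pass local_x_def padd_def seg_u_def seg_h_def digit_opt_def)
  thus ?thesis using s' assms by simp
qed

lemma seed_height_last: "seed_height (W - Suc 0) = H" using W_mod(1) by (simp add: seed_height_def)

lemma link_turn:
  assumes "i < 4" "1 \<le> p" "p \<le> Q"
  shows "link (pred_cell (i, p, 0, 0)) (i, p, 0, 0)"
proof (cases "p = 1")
  case True
  have "link (i, 0, W - 1, H - 1) (i, p, 0, 0)"
    using assms True H
    by (intro link_local)
      (auto simp: Seed_in_V seed_height_simps local_pos_def local_x_def padd_def seg_u_def seg_h_def digit_opt_def W_def mode_at_def)
  thus ?thesis using True assms by (simp add: seed_height_last)
next
  case False
  then obtain p' where p': "p = Suc p'" "p' \<ge> 1" using assms by (cases p) auto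
  \<comment> \<open>After an odd pass the final carry is set exactly for \<open>p' = Q - 1\<close>,
    so \<open>turn\<close> chooses \<open>Fin\<close> there and \<open>Copy\<close>
    otherwise.\<close>
  have tm: "turn i (mode_at p' k) = Some (i, KLab (Seg 0 (mode_at p 0) None))"
    using counter_overflow[of p'] assms p' by (auto simp: mode_at_def)
  have "link (i, p', k, 5) (i, p, 0, 0)"
    using assms p' tm last_seg_iff[of k p'] k
    by (intro link_local) (auto simp: Pass_in_V local_pos_Pass local_x_def padd_def seg_u_def seg_h_def digit_opt_def W_def)
  thus ?thesis using False assms p' by simp
qed

lemma link_Seed:
  assumes "i < 4" "u < W" "v < seed_height u" "u > 0 \<or> v > 0"
  shows "link (pred_cell (i, 0, u, v)) (i, 0, u, v)"
proof (cases "v > 0")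
  case True
  have "link (i, 0, u, v - 1) (i, 0, u, v)"
    using assms True by (intro link_local) (auto simp: Seed_in_V local_pos_def local_x_def padd_def)
  thus ?thesis using True assms R by (simp add: Q_def)
next
  case False
  then obtain u' where u': "u = Suc u'" using assms by (cases u) auto
  have c: "seed_height u' = seed_height u" if "even u'" using seed_height_odd[of u] that u' by simp
  have "link (i, 0, u', seed_height u' - 1) (i, 0, u, v)"
    using assms False u' c seed_height_pos[of u'] seed_height_pos[of u]
    by (intro link_local) (auto simp: Seed_in_V local_pos_def local_x_def padd_def)
  thus ?thesis using False u' assms by simp
qed

lemma link_strip:
  assumes "0 < i" "i < 4"
  shows "link (pred_cell (i, 0, 0, 0)) (i, 0, 0, 0)"
proof -
  obtain j where j: "i = Suc j" "j < 3" using assms by (cases i) auto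
  have q: "even Q" "1 \<le> Q" "Q \<noteq> 0" using R by (auto simp: Q_def)
  have "cell_pos (i, 0, 0, 0) = padd (cell_pos (j, Q, k, 5)) (dvec (rot j North))"
  proof -
    have "j = 0 \<or> j = 1 \<or> j = 2" using j by auto
    thus ?thesis using q j k
      by (auto simp: rot_pos_def local_pos_def local_x_def seg_u_def seg_h_def padd_def rot_simps seed_height_def Q_def N_def M_def W_def)
  qed
  moreover have "emits j (label_of (j, Q, k, 5)) North = Some (i, KLab (Seed 0 0))"
    using j q last_seg_iff[of k Q] by (auto simp: mode_at_def)
  moreover have "(j, Q, k, 5) \<in> V" using j q by (simp add: Pass_in_V)
  ultimately have "link (j, Q, k, 5) (i, 0, 0, 0)"
    unfolding link_def using j by (auto simp: rot_Suc_West simp del: emits.simps cell_pos.simps intro!: exI[of _ North])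
  thus ?thesis using j by simp
qed

lemma W_less_M: "W < M" "W > 0" using R by (auto simp: W_def M_def)

lemma link_Centre:
  assumes "W \<le> x" "x < M" "W \<le> y" "y < M"
  shows "link (pred_cell (4, 0, x, y)) (4, 0, x, y)"
proof -
  have q: "even Q" "1 \<le> Q" "Q \<noteq> 0" using R by (auto simp: Q_def)
  consider "x > W" | "x = W" "y > W" | "x = W" "y = W" using assms by fastforce
  thus ?thesis
  proof cases
    case 1
    hence "link (4, 0, x - 1, y) (4, 0, x, y)" using assms
      by (auto simp: link_def Seed_in_V padd_def rot_simps intro!: exI[of _ East])
    thus ?thesis using 1 by simp
  next
    case 2
    hence "link (4, 0, x, y - 1) (4, 0, x, y)" using assms
      by (auto simp: link_def Seed_in_V padd_def rot_simps intro!: exI[of _ North])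
    thus ?thesis using 2 by simp
  next
    case 3
    \<comment> \<open>The local east side of the port faces north globally, and the port lies
      directly below the corner \<open>(W, W)\<close> of the centre.\<close>
    have "link (3, Q, 0, 1) (4, 0, x, y)" using 3 q W_less_M R
      by (auto simp: link_def Seed_in_V Pass_in_V padd_def rot_simps rot_pos_def local_pos_def local_x_def seg_u_def seg_h_def mode_at_def
        digit_opt_def N_def M_def Q_def W_def intro!: exI[of _ East])
    thus ?thesis using 3 by simp
  qed
qed

lemma link_pred_cell:
  assumes "c \<in> V" "c \<noteq> c0"
  shows "link (pred_cell c) c"
  using assms(1)
proof (cases rule: V_cases)
  case (Seed i u v)
  show ?thesis
  proof (cases "u > 0 \<or> v > 0")
    case True
    thus ?thesis using Seed link_Seed by simp
  next
    case False
    thus ?thesis using Seed link_strip assms(2) by (auto simp: c0_def simp del: pred_cell.simps)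
  qed
next
  case (Pass i p s e)
  thus ?thesis using link_Pass link_exit link_turn by (metis gr0I)
next
  case (Centre x y)
  thus ?thesis using link_Centre by simp
qed

section \<open>The cells tile the square\<close>

lemma local_pos_box:
  assumes "(i, p, s, e) \<in> V" "i < 4"
  obtains x y where "local_pos p s e = (x, y)" "0 \<le> x" "x < int W" "0 \<le> y" "y < int M"
proof -
  have "fst (local_pos p s e) \<ge> 0 \<and> fst (local_pos p s e) < int W \<and> snd (local_pos p s e) \<ge> 0 \<and> snd (local_pos p s e) < int M"
    using assms(1)
  proof (cases rule: V_cases)
    case (Seed j u v)
    have "seed_height u \<le> H + 1" by (simp add: seed_height_def)
    thus ?thesis using Seed R by (auto simp: local_pos_def local_x_def M_def)
  next
    case (Pass j q t f)
    have "even Q" by (simp add: Q_def)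
    have "0 \<le> 4 * int t + seg_u f" by (simp add: seg_u_def)
    moreover have "4 * int t + seg_u f < int W" using Pass by (auto simp: seg_u_def W_def)
    moreover have "0 \<le> seg_h f" by (simp add: seg_h_def)
    moreover have "2 * (int q - 1) + seg_h f < 4 * int R" using Pass by (auto simp: seg_h_def Q_def)
    ultimately show ?thesis using Pass by (auto simp: local_pos_Pass local_x_def M_def)
  qed (use assms in auto)
  thus ?thesis using that by (cases "local_pos p s e") auto
qed

lemma seg_u_h_inj: "e < 8 \<Longrightarrow> e' < 8 \<Longrightarrow> seg_u e = seg_u e' \<Longrightarrow> seg_h e = seg_h e' \<Longrightarrow> e = e'"
  unfolding less8 by (elim disjE) (auto simp: seg_u_def seg_h_def)

lemma seg_h_u:
  "e < 8 \<Longrightarrow> seg_h e = 2 \<Longrightarrow> seg_u e = 0 \<or> seg_u e = 1"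
  "e < 8 \<Longrightarrow> seg_h e = 0 \<Longrightarrow> seg_u e = 0 \<or> seg_u e = 3"
  by (auto simp: seg_h_def seg_u_def split: if_splits)

text \<open>Only a bump of pass \<open>p\<close> and the bottom row of pass \<open>p + 1\<close> can
  meet. Consecutive passes run in opposite directions, so their coordinates for a common position
  add up to \<open>W - 1\<close>, which is 2 modulo 4. Bumps have residue 0 or 1, bottom cells 0 or
  3, and no such sum is 2.\<close>

lemma local_pos_Pass_neq:
  assumes "p \<ge> 1" "e < 8" "e' < 8" "local_pos p s e = local_pos p' s' e'" "p < p'"
  shows False
proof -
  have "local_x p (4 * int s + seg_u e) = local_x p' (4 * int s' + seg_u e')"
    and y: "2 * int p + seg_h e = 2 * int p' + seg_h e'" using assms by (auto simp: local_pos_Pass)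
  have "seg_h e \<le> 2" "seg_h e' \<ge> 0" by (auto simp: seg_h_def)
  hence "p' = p + 1" "seg_h e = 2" "seg_h e' = 0" using y assms by auto
  hence u: "seg_u e = 0 \<or> seg_u e = 1" "seg_u e' = 0 \<or> seg_u e' = 3" using assms(2,3) seg_h_u by blast+
  have "4 * int s + seg_u e + (4 * int s' + seg_u e') = 4 * int k + 2"
    using \<open>local_x p _ = _\<close> \<open>p' = p + 1\<close> by (auto simp: local_x_def W_def split: if_splits)
  hence "4 * (int s + int s' - int k) + seg_u e + seg_u e' = 2" by simp
  then obtain z :: int where "4 * z + seg_u e + seg_u e' = 2" by blast
  thus False using u by presburger
qed

text \<open>The same obstruction modulo 4, with the raised seed columns as bumps below pass
  1.\<close>

lemma local_pos_Seed_Pass_neq: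
  assumes "u < W" "v < seed_height u" "p \<ge> 1" "e < 8" "local_pos 0 u v = local_pos p s e"
  shows False
proof -
  have x: "int W - 1 - int u = local_x p (4 * int s + seg_u e)"
    and y: "(if even u then int v else int (seed_height u) - 1 - int v) = int H + 2 * (int p - 1) + seg_h e"
    using assms by (auto simp: local_pos_Pass local_pos_def local_x_def)
  have "seg_h e \<ge> 0" by (auto simp: seg_h_def)
  moreover have "seed_height u \<le> H + 1" by (simp add: seed_height_def)
  ultimately have "p = 1" "seg_h e = 0" "seed_height u = H + 1" using y assms by (auto split: if_splits)
  moreover from this have "seg_u e = 0 \<or> seg_u e = 3" using assms(4) seg_h_u by blast
  moreover have "u mod 4 = 0 \<or> u mod 4 = 1" using \<open>seed_height u = H + 1\<close> by (auto simp: seed_height_def split: if_splits)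
  ultimately show False using x by (simp add: local_x_def W_def) presburger
qed

lemma local_pos_inj:
  assumes "(i, p, s, e) \<in> V" "(i, p', s', e') \<in> V" "i < 4" "local_pos p s e = local_pos p' s' e'"
  shows "p = p' \<and> s = s' \<and> e = e'"
proof -
  have c: "p = 0 \<and> s < W \<and> e < seed_height s \<or> p \<ge> 1 \<and> e < 8"
    "p' = 0 \<and> s' < W \<and> e' < seed_height s' \<or> p' \<ge> 1 \<and> e' < 8"
    using assms by (auto simp: V_def)
  consider "p = 0" "p' = 0" | "p = 0" "p' \<ge> 1" | "p \<ge> 1" "p' = 0" | "p \<ge> 1" "p' \<ge> 1" by linarith
  thus ?thesis
  proof cases
    case 1
    hence "s = s'" using assms by (auto simp: local_pos_def local_x_def)
    thus ?thesis using 1 assms c by (auto simp: local_pos_def split: if_splits)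
  next
    case 2
    thus ?thesis using local_pos_Seed_Pass_neq[of s e p' e' s'] assms c by auto
  next
    case 3
    thus ?thesis using local_pos_Seed_Pass_neq[of s' e' p e s] assms c by auto
  next
    case 4
    hence e: "e < 8" "e' < 8" using c by auto
    have p: "p = p'" using local_pos_Pass_neq[OF 4(1) e assms(4)] local_pos_Pass_neq[OF 4(2) e(2,1) assms(4)[symmetric]]
      by (metis linorder_neqE_nat)
    hence "seg_h e = seg_h e'" "4 * int s + seg_u e = 4 * int s' + seg_u e'"
      using assms 4 by (auto simp: local_pos_Pass local_x_def split: if_splits)
    moreover have "0 \<le> seg_u e" "seg_u e < 4" "0 \<le> seg_u e'" "seg_u e' < 4" by (auto simp: seg_u_def)
    ultimately have "s = s'" "seg_u e = seg_u e'" "seg_h e = seg_h e'" by presburger+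
    thus ?thesis using p seg_u_h_inj[OF e] by simp
  qed
qed

text \<open>Above the seed, every two rows belong to one pass. Its lower row has gaps at the
  residues 1 and 2; mirrored into the coordinates of the pass below, these become 1 and 0, exactly
  the places of its bumps.\<close>

lemma local_pos_surj:
  assumes "x < W" "y < M" "i < 4"
  shows "\<exists>p s e. (i, p, s, e) \<in> V \<and> local_pos p s e = (int x, int y)"
proof (cases "y < H")
  case True
  define u where "u = W - 1 - x"
  define v where "v = (if even u then y else seed_height u - 1 - y)"
  have "H \<le> seed_height u" by (simp add: seed_height_def)
  hence "(i, 0, u, v) \<in> V \<and> local_pos 0 u v = (int x, int y)"
    using assms True by (auto simp: Seed_in_V u_def v_def local_pos_def local_x_def)
  thus ?thesis by blast
next
  case False
  obtain p h where ph: "y - H = 2 * (p - 1) + h" "h < 2" "p \<ge> 1"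
    by (rule that[of "(y - H) div 2 + 1" "(y - H) mod 2"]) auto
  hence y: "y = H + 2 * (p - 1) + h" using False by simp
  have pQ: "p \<le> Q" using y assms by (auto simp: M_def Q_def)
  have ev: "even Q" by (simp add: Q_def)
  define u where "u = (if odd p then x else W - 1 - x)"
  have uW: "u < 4 * k + 3" using assms by (auto simp: u_def W_def)
  have lxu: "local_x p (int u) = int x" using assms by (auto simp: local_x_def u_def)
  have here: ?thesis if "u = 4 * s + nat (seg_u e)" "int h = seg_h e" "e < 8" "s = k \<longrightarrow> e \<le> 5" "s \<le> k" "e \<noteq> 2 \<and> e \<noteq> 3" for s e
  proof -
    have "int u = 4 * int s + seg_u e" using that(1) by (auto simp: seg_u_def)
    hence "local_pos p s e = (int x, int y)" using lxu that ph y by (auto simp: local_pos_Pass)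
    thus ?thesis using that ph pQ assms by (intro exI[of _ p] exI[of _ s] exI[of _ e]) (simp add: Pass_in_V)
  qed
  have below: ?thesis if "h = 0" "u mod 4 = 1 \<or> u mod 4 = 2"
  proof -
    define u' where "u' = W - 1 - u"
    have u'W: "u' < 4 * k + 3" by (simp add: u'_def W_def)
    have u': "int u' = 4 * int k + 2 - int u" using uW by (auto simp: u'_def W_def)
    have m: "u' mod 4 = 0 \<or> u' mod 4 = 1"
    proof (cases u rule: mod4_cases)
      case (2 a)
      hence "u' = 4 * (k - a) + 1" using u' uW by auto
      thus ?thesis by simp
    next
      case (3 a)
      hence "u' = 4 * (k - a)" using u' uW by auto
      thus ?thesis by simp
    qed (use that(2) in auto)
    show ?thesis
    proof (cases "p = 1")
      case True
      define v where "v = (if even u' then H else 0)"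
      have c: "seed_height u' = H + 1" using m by (auto simp: seed_height_def)
      have "int W - 1 - int u' = int x" using True u' by (auto simp: u_def W_def)
      hence "local_pos 0 u' v = (int x, int y)" using c True that y by (auto simp: local_pos_def local_x_def v_def)
      moreover have "(i, 0, u', v) \<in> V" using c u'W assms by (auto simp: Seed_in_V v_def W_def)
      ultimately show ?thesis by blast
    next
      case False
      define p' where "p' = p - 1"
      have p': "p = p' + 1" "p' \<ge> 1" using False ph by (auto simp: p'_def)
      define s e where "s = u' div 4" and "e = 2 + u' mod 4"
      have e: "e = 2 \<or> e = 3" "seg_u e = int (u' mod 4)" "seg_h e = 2" using m by (auto simp: e_def seg_u_def seg_h_def)
      have "int u' = 4 * int s + seg_u e" unfolding e(2) s_def by presburger
      moreover have "local_x p' (int u') = int x" using lxu u' p' by (auto simp: local_x_def W_def split: if_splits)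
      ultimately have "local_pos p' s e = (int x, int y)" using p' e(3) y that by (auto simp: local_pos_Pass)
      moreover have "(i, p', s, e) \<in> V" using p' e pQ assms u'W by (auto simp: Pass_in_V s_def)
      ultimately show ?thesis by blast
    qed
  qed
  show ?thesis
  proof (cases u rule: mod4_cases)
    case (1 a)
    thus ?thesis using here[of a h] ph uW by (cases "h = 0") (auto simp: seg_u_def seg_h_def less_2_cases_iff)
  next
    case (2 a)
    thus ?thesis using here[of a 4] below ph uW by (cases "h = 0") (auto simp: seg_u_def seg_h_def less_2_cases_iff)
  next
    case (3 a)
    thus ?thesis using here[of a 5] below ph uW by (cases "h = 0") (auto simp: seg_u_def seg_h_def less_2_cases_iff mod_Suc)
  next
    case (4 a)
    \<comment> \<open>At residue 3 the reader is the lower cell and the guard the upper one, so the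
      index decreases with the height.\<close>
    thus ?thesis using here[of a "7 - h"] ph uW by (cases "h = 0") (auto simp: seg_u_def seg_h_def less_2_cases_iff)
  qed
qed

lemma rot_pos_box_disjoint:
  assumes "i < 4" "j < 4" "rot_pos i (x, y) = rot_pos j (x', y')"
    "0 \<le> x" "x < int W" "0 \<le> y" "y < int M" "0 \<le> x'" "x' < int W" "0 \<le> y'" "y' < int M"
  shows "i = j \<and> x = x' \<and> y = y'"
  using assms W_less_M unfolding less4 by (auto simp: rot_pos_def N_def)

lemma rot_pos_box_centre:
  assumes "i < 4" "rot_pos i (x, y) = (int x', int y')"
    "0 \<le> x" "x < int W" "0 \<le> y" "y < int M" "W \<le> x'" "x' < M" "W \<le> y'" "y' < M"
  shows False
  using assms W_less_M unfolding less4 by (auto simp: rot_pos_def N_def)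

lemma V_tag: "(i, p, s, e) \<in> V \<Longrightarrow> \<not> i < 4 \<Longrightarrow> i = 4 \<and> p = 0 \<and> W \<le> s \<and> s < M \<and> W \<le> e \<and> e < M"
  by (auto simp: V_def)

lemma cell_pos_inj: "inj_on cell_pos V"
proof (rule inj_onI)
  fix c d assume V: "c \<in> V" "d \<in> V" and eq: "cell_pos c = cell_pos d"
  obtain i p s e where c: "c = (i, p, s, e)" by (cases c)
  obtain j q t f where d: "d = (j, q, t, f)" by (cases d)
  consider "i < 4" "j < 4" | "i < 4" "\<not> j < 4" | "\<not> i < 4" "j < 4" | "\<not> i < 4" "\<not> j < 4" by blast
  thus "c = d"
  proof cases
    case 1
    obtain x y where xy: "local_pos p s e = (x, y)" "0 \<le> x" "x < int W" "0 \<le> y" "y < int M"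
      using local_pos_box V c 1 by blast
    obtain x' y' where xy': "local_pos q t f = (x', y')" "0 \<le> x'" "x' < int W" "0 \<le> y'" "y' < int M"
      using local_pos_box V d 1 by blast
    have "i = j \<and> x = x' \<and> y = y'" using eq 1 c d xy xy' by (intro rot_pos_box_disjoint) auto
    thus ?thesis using local_pos_inj[of i p s e q t f] V c d 1 xy xy' by auto
  next
    case 2
    obtain x y where xy: "local_pos p s e = (x, y)" "0 \<le> x" "x < int W" "0 \<le> y" "y < int M"
      using local_pos_box V c 2 by blast
    thus ?thesis using rot_pos_box_centre[OF 2(1), of x y t f] V_tag[of j q t f] V 2 eq c d by auto
  next
    case 3
    obtain x y where xy: "local_pos q t f = (x, y)" "0 \<le> x" "x < int W" "0 \<le> y" "y < int M"
      using local_pos_box V d 3 by blast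
    thus ?thesis using rot_pos_box_centre[OF 3(2), of x y s e] V_tag[of i p s e] V 3 eq c d by auto
  next
    case 4
    thus ?thesis using V_tag[of j q t f] V_tag[of i p s e] V eq c d by auto
  qed
qed

lemma cell_pos_box:
  assumes "0 \<le> x" "x < int W" "0 \<le> y" "y < int M" "i < 4"
  shows "\<exists>p s e. (i, p, s, e) \<in> V \<and> cell_pos (i, p, s, e) = rot_pos i (x, y)"
proof -
  obtain p s e where "(i, p, s, e) \<in> V" "local_pos p s e = (int (nat x), int (nat y))"
    using local_pos_surj[of "nat x" "nat y" i] assms by (metis nat_less_iff)
  hence "(i, p, s, e) \<in> V" "cell_pos (i, p, s, e) = rot_pos i (x, y)" using assms by auto
  thus ?thesis by blast
qed

lemma cell_pos_image: "cell_pos ` V = square N"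
proof (intro subset_antisym subsetI)
  fix z assume "z \<in> cell_pos ` V"
  then obtain i p s e where V: "(i, p, s, e) \<in> V" and z: "z = cell_pos (i, p, s, e)" by auto
  show "z \<in> square N"
  proof (cases "i < 4")
    case True
    obtain x y where xy: "local_pos p s e = (x, y)" "0 \<le> x" "x < int W" "0 \<le> y" "y < int M"
      using local_pos_box[OF V True] by blast
    thus ?thesis using True z unfolding less4 by (auto simp: rot_pos_def square_def N_def)
  next
    case False
    thus ?thesis using V_tag[OF V] z by (auto simp: square_def N_def)
  qed
next
  fix z assume "z \<in> square N"
  then obtain x y where z: "z = (x, y)" "0 \<le> x" "x < int N" "0 \<le> y" "y < int N" by (auto simp: square_def)
  \<comment> \<open>The pinwheel dissection: west, north, east and south strip, and the central
    square of side \<open>M - W\<close>.\<close>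
  consider "x < W" "y < M" | "x < M" "y \<ge> M" | "x \<ge> M" "y \<ge> W" | "x \<ge> W" "y < W" | "W \<le> x" "x < M" "W \<le> y" "y < M"
    using W_less_M by linarith
  thus "z \<in> cell_pos ` V"
  proof cases
    case 1
    hence "rot_pos 0 (x, y) = z" using z by (simp add: rot_pos_def)
    thus ?thesis using cell_pos_box[of x y 0] z 1 by force
  next
    case 2
    hence "rot_pos 1 (int N - 1 - y, x) = z" using z by (simp add: rot_pos_def)
    thus ?thesis using cell_pos_box[of "int N - 1 - y" x 1] z 2 by (force simp: N_def)
  next
    case 3
    hence "rot_pos 2 (int N - 1 - x, int N - 1 - y) = z" using z by (simp add: rot_pos_def)
    thus ?thesis using cell_pos_box[of "int N - 1 - x" "int N - 1 - y" 2] z 3 by (force simp: N_def)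
  next
    case 4
    hence "rot_pos 3 (y, int N - 1 - x) = z" using z by (simp add: rot_pos_def)
    thus ?thesis using cell_pos_box[of y "int N - 1 - x" 3] z 4 by (force simp: N_def)
  next
    case 5
    have "(4, 0, nat x, nat y) \<in> V" using z 5 by (auto simp: V_def)
    moreover have "cell_pos (4, 0, nat x, nat y) = z" using z 5 by auto
    ultimately show ?thesis by (metis imageI)
  qed
qed

lemma finite_V: "finite V"
proof -
  have "finite (cell_pos ` V)"
    unfolding cell_pos_image square_def
    by (rule finite_subset[of _ "{0..int N} \<times> {0..int N}"]) auto
  thus ?thesis using cell_pos_inj by (rule finite_imageD)
qed

section \<open>Order of placement and emitted glues\<close>

text \<open>On the strips \<open>pred_cell\<close> is the immediate predecessor in the lexicographic
  order; in the last pass it jumps from index 4 to 1 because 2 and 3 are absent there. The centre is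
  excluded since its rows grow independently.\<close>

lemma pred_cell_gap:
  assumes "(i, p, s, e) \<in> V" "c' \<in> V" "i < 4" "cell_less c' (i, p, s, e)" "c' \<noteq> pred_cell (i, p, s, e)"
  shows "cell_less c' (pred_cell (i, p, s, e))"
proof -
  obtain i' p' s' e' where c': "c' = (i', p', s', e')" by (cases c')
  have "i' < 4" using assms c' by auto
  have L: "i' < i \<or> i' = i \<and> (p' < p \<or> p' = p \<and> (s' < s \<or> s' = s \<and> e' < e))"
    using assms(4) c' by simp
  have v0: "p' = 0 \<Longrightarrow> s' \<le> W - 1 \<and> e' \<le> seed_height s' - 1"
    using assms(2) c' \<open>i' < 4\<close> by (auto simp: V_def)
  have vp: "p' > 0 \<Longrightarrow> p' \<le> Q \<and> s' \<le> k \<and> e' \<le> 7 \<and> (s' = k \<longrightarrow> e' \<le> 5)"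
    and vQ: "p' = Q \<Longrightarrow> e' \<noteq> 2 \<and> e' \<noteq> 3"
    using assms(2) c' \<open>i' < 4\<close> R by (auto simp: V_def Q_def)
  have Q: "Q > 0" using R by (simp add: Q_def)
  have pQ: "p' \<le> Q" using vp by (cases "p' = 0") auto
  have ne: "(i', p', s', e') \<noteq> pred_cell (i, p, s, e)" using assms(5) c' by simp
  consider "e > 0" "p = Q" "e = 4" | "e > 0" "\<not> (p = Q \<and> e = 4)" | "e = 0" "s > 0" "p = 0"
    | "e = 0" "s > 0" "p > 0" | "e = 0" "s = 0" "p > 1" | "e = 0" "s = 0" "p = 1" | "e = 0" "s = 0" "p = 0" "i > 0"
    using L by fastforce
  thus ?thesis
  proof cases
    case 1
    hence "pred_cell (i, p, s, e) = (i, p, s, 1)" using assms(3) by simp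
    moreover have "p' = p \<Longrightarrow> e' < 4 \<Longrightarrow> e' \<noteq> 1 \<Longrightarrow> e' < 1" using vQ 1 by force
    ultimately show ?thesis using L ne 1(3) unfolding c' by auto
  next
    case 2
    hence "pred_cell (i, p, s, e) = (i, p, s, e - 1)" using assms(3) by auto
    thus ?thesis using L ne unfolding c' by auto
  next
    case 3
    hence "pred_cell (i, p, s, e) = (i, p, s - 1, seed_height (s - 1) - 1)" using assms(3) by auto
    moreover have "p' = p \<Longrightarrow> e' \<le> seed_height s' - 1" using v0 3 by auto
    ultimately show ?thesis using L ne 3 unfolding c' by (cases "s' = s - 1") auto
  next
    case 4
    hence "pred_cell (i, p, s, e) = (i, p, s - 1, 7)" using assms(3) by auto
    moreover have "p' = p \<Longrightarrow> e' \<le> 7" using vp 4 by auto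
    ultimately show ?thesis using L ne 4 unfolding c' by (cases "s' = s - 1") auto
  next
    case 5
    hence "pred_cell (i, p, s, e) = (i, p - 1, k, 5)" using assms(3) by auto
    moreover have "p' = p - 1 \<Longrightarrow> s' \<le> k \<and> (s' = k \<longrightarrow> e' \<le> 5)" using vp 5 by auto
    ultimately show ?thesis using L ne 5 unfolding c' by (cases "p' = p - 1") auto
  next
    case 6
    hence "pred_cell (i, p, s, e) = (i, 0, W - 1, seed_height (W - 1) - 1)" using assms(3) by auto
    thus ?thesis using L ne 6 v0 unfolding c' by (cases "s' = W - 1") auto
  next
    case 7
    hence "pred_cell (i, p, s, e) = (i - 1, Q, k, 5)" using assms(3) by auto
    moreover have "p' = Q \<Longrightarrow> s' \<le> k \<and> (s' = k \<longrightarrow> e' \<le> 5)" using vp Q by auto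
    ultimately show ?thesis using L ne 7 pQ unfolding c' by (cases "i' = i - 1"; cases "p' = Q") auto
  qed
qed

lemma c0_in_V: "c0 \<in> V" using W_less_M seed_height_pos by (auto simp: c0_def Seed_in_V)

lemma pred_cell_strip: "i < 4 \<Longrightarrow> fst (pred_cell (i, p, s, e)) < 4" by auto

text \<open>With no gaps below a cell, closure under predecessors amounts to containing all earlier
  cells. This is how the presence of guards, digits and walls is obtained later.\<close>

lemma prefix:
  assumes D: "down_closed V pred_cell c0 A" and "c \<in> A" "fst c < 4" "c' \<in> V" "cell_less c' c"
  shows "c' \<in> A"
  using wf_cell_less assms(2-5)
proof (induction c rule: wf_induct_rule)
  case (less c)
  obtain i p s e where c: "c = (i, p, s, e)" by (cases c)
  have "c \<noteq> c0" using less.prems by (cases c') (auto simp: c0_def)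
  hence p: "pred_cell c \<in> A" "cell_less (pred_cell c) c" using D less.prems link_pred_cell[of c]
    by (auto simp: down_closed_def link_def simp del: pred_cell.simps)
  show ?case
  proof (cases "c' = pred_cell c")
    case False
    hence "cell_less c' (pred_cell c)" using pred_cell_gap[of i p s e c'] less.prems D c by (auto simp: down_closed_def simp del: pred_cell.simps)
    thus ?thesis using less.IH[of "pred_cell c"] p less.prems pred_cell_strip[of i p s e] c by (auto simp del: pred_cell.simps)
  qed (use p in simp)
qed

text \<open>A chain of predecessors can leave the centre only through the port.\<close>

lemma centre_port:
  assumes D: "down_closed V pred_cell c0 A"
  shows "c \<in> A \<Longrightarrow> \<not> fst c < 4 \<Longrightarrow> (3, Q, 0, 1) \<in> A"
  using wf_cell_less
proof (induction c rule: wf_induct_rule)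
  case (less c)
  obtain i p s e where c: "c = (i, p, s, e)" by (cases c)
  have "c \<noteq> c0" using less.prems by (auto simp: c0_def)
  hence p: "pred_cell c \<in> A" "cell_less (pred_cell c) c" using D less.prems link_pred_cell[of c]
    by (auto simp: down_closed_def link_def simp del: pred_cell.simps)
  show ?case
  proof (cases "pred_cell c = (3, Q, 0, 1)")
    case False
    hence "\<not> fst (pred_cell c) < 4" using c less.prems by (auto split: if_splits)
    thus ?thesis using less.IH p by blast
  qed (use p in simp)
qed

section \<open>The notch around a reader\<close>

fun guard_cell :: "cell \<Rightarrow> cell" where
  "guard_cell (i, p, s, e) = (if p = 1 then (i, 0, 4 * (k - 1 - s) + 3, 0) else (i, p - 1, k - 1 - s, 6))"
fun digit_cell :: "cell \<Rightarrow> cell" where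
  "digit_cell (i, p, s, e) = (if p = 1 then (i, 0, 4 * (k - s), H) else (i, p - 1, k - s, 2))"

text \<open>The coordinates of two consecutive passes add up to \<open>4 * k + 2\<close>. Thus the
  reader at \<open>4 * s + 3\<close> stands above old coordinate \<open>4 * (k - 1 - s) + 3\<close>,
  a guard, and just behind it lies old coordinate \<open>4 * (k - s)\<close>, the bump with the
  digit. The order facts are what the argument rests on: the guard precedes the digit, and the digit
  precedes the tile that announces the reader.\<close>

lemma reader:
  assumes "i < 4" "1 \<le> p" "p \<le> Q" "s < k" "c = (i, p, s, 7)"
  shows "c \<in> V" "label_of c = Reader (mode_at p s) (digit_at (p - 1) (column p (s + 1)))"
    "guard_cell c \<in> V" "digit_cell c \<in> V" "cell_less (guard_cell c) (digit_cell c)" "cell_less (digit_cell c) c" "cell_less (digit_cell c) (pred_cell c)"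
    "strip_of (guard_cell c) = i" "strip_of (digit_cell c) = i" "fst (digit_cell c) = i" "fst (guard_cell c) = i"
    "neg_side (label_of (guard_cell c)) North"
    "emits i (label_of (digit_cell c)) (heading (mode_at p s)) = Some (i, KDigit (digit_at (p - 1) (column p (s + 1))))"
    "cell_pos (guard_cell c) = padd (cell_pos c) (dvec (rot i South))"
    "cell_pos (digit_cell c) = padd (cell_pos c) (dvec (rot i (opp (heading (mode_at p s)))))"
proof -
  have ev: "even Q" by (simp add: Q_def)
  note c = assms(5)
  show "c \<in> V" using assms by (simp add: Pass_in_V)
  show "label_of c = Reader (mode_at p s) (digit_at (p - 1) (column p (s + 1)))" using assms by simp
  have ic: "int (k - s) = int k - int s" "int (k - Suc s) = int k - int s - 1" using assms by auto
  consider "p = 1" | q where "p = Suc q" "q \<ge> 1" using assms(2) by (cases "p = 1"; cases p) auto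
  note cs = this
  show "guard_cell c \<in> V" "digit_cell c \<in> V" "cell_less (guard_cell c) (digit_cell c)" "cell_less (digit_cell c) c" "cell_less (digit_cell c) (pred_cell c)"
    "strip_of (guard_cell c) = i" "strip_of (digit_cell c) = i" "fst (digit_cell c) = i" "fst (guard_cell c) = i"
    using assms H by (cases rule: cs; auto simp: Seed_in_V Pass_in_V W_def seed_height_simps)+
  show "neg_side (label_of (guard_cell c)) North"
    using assms by (cases rule: cs) (auto simp: mode_at_Fin)
  show "emits i (label_of (digit_cell c)) (heading (mode_at p s)) = Some (i, KDigit (digit_at (p - 1) (column p (s + 1))))"
    using assms by (cases rule: cs) (auto simp: heading_mode_at seed_height_simps digit_opt_def column_def)
  have "local_pos (fst (snd (guard_cell c))) (fst (snd (snd (guard_cell c)))) (snd (snd (snd (guard_cell c)))) = padd (local_pos p s 7) (dvec South)"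
    using assms H by (cases rule: cs) (auto simp: local_pos_def local_x_def padd_def seg_u_def seg_h_def seed_height_simps W_def ic)
  thus "cell_pos (guard_cell c) = padd (cell_pos c) (dvec (rot i South))"
    using assms by (auto simp: rot_pos_padd[symmetric] simp del: dvec.simps)
  have "local_pos (fst (snd (digit_cell c))) (fst (snd (snd (digit_cell c)))) (snd (snd (snd (digit_cell c)))) = padd (local_pos p s 7) (dvec (opp (heading (mode_at p s))))"
    using assms H by (cases rule: cs) (auto simp: local_pos_def local_x_def padd_def seg_u_def seg_h_def seed_height_simps W_def heading_mode_at ic)
  thus "cell_pos (digit_cell c) = padd (cell_pos c) (dvec (rot i (opp (heading (mode_at p s)))))"
    using assms by (auto simp: rot_pos_padd[symmetric] simp del: dvec.simps)
qed

text \<open>These are the positions at which the fillers and the riser column run out. They lie in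
  the strips before strip 3, hence are filled before the port.\<close>

lemma wall:
  assumes "x = int M \<and> int W \<le> y \<and> y < int M \<or> x = int W \<and> y = int M"
  shows "\<exists>c\<in>V. fst c < 4 \<and> cell_less c (3, Q, 0, 1) \<and> cell_pos c = (x, y)"
proof -
  have "(x, y) \<in> cell_pos ` V" unfolding cell_pos_image using assms W_less_M by (auto simp: square_def N_def)
  then obtain i p s e where c: "(i, p, s, e) \<in> V" "cell_pos (i, p, s, e) = (x, y)" by auto
  have i: "i < 4" using V_tag[OF c(1)] c(2) assms by (cases "i < 4") auto
  obtain x' y' where xy: "local_pos p s e = (x', y')" "0 \<le> x'" "x' < int W" "0 \<le> y'" "y' < int M"
    using local_pos_box[OF c(1) i] .
  have "i \<noteq> 3" using c(2) xy assms W_less_M by (auto simp: rot_pos_def)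
  hence "cell_less (i, p, s, e) (3, Q, 0, 1)" using i by auto
  thus ?thesis using c i by (intro bexI[of _ "(i, p, s, e)"]) auto
qed

section \<open>Targets of emitted glues\<close>

definition onward :: "cell \<Rightarrow> dir \<Rightarrow> nat \<Rightarrow> key \<Rightarrow> bool" where
  "onward c d j \<kappa> \<longleftrightarrow> (\<exists>c'\<in>V. c' \<noteq> c0 \<and> pred_cell c' = c \<and> strip_of c' = j \<and> in_key (label_of c') = \<kappa> \<and>
     rot (strip_of c') (in_dir (label_of c')) = rot (strip_of c) d)"

definition feeds :: "cell \<Rightarrow> dir \<Rightarrow> nat \<Rightarrow> key \<Rightarrow> bool" where
  "feeds c d j \<kappa> \<longleftrightarrow> (\<exists>p s. j < 4 \<and> 1 \<le> p \<and> p \<le> Q \<and> s < k \<and> digit_cell (j, p, s, 7) = c \<and>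
     d = heading (mode_at p s) \<and> \<kappa> = KDigit (digit_at (p - 1) (column p (s + 1))))"

definition walled :: "cell \<Rightarrow> dir \<Rightarrow> bool" where
  "walled c d \<longleftrightarrow> \<not> fst c < 4 \<and> (\<exists>c'\<in>V. fst c' < 4 \<and> cell_less c' (3, Q, 0, 1) \<and>
     cell_pos c' = padd (cell_pos c) (dvec (rot (strip_of c) d)))"

lemma emission_Seed:
  assumes "i < 4" "u < W" "v < seed_height u" "emits i (Seed u v) d = Some (j, \<kappa>)"
  shows "onward (i, 0, u, v) d j \<kappa> \<or> feeds (i, 0, u, v) d j \<kappa>"
proof -
  have Q: "Q \<noteq> 0" "Q \<ge> Suc 0" using R by (auto simp: Q_def)
  consider (up) "v + 1 < seed_height u" "d = (if even u then North else South)" "j = i" "\<kappa> = KLab (Seed u (v + 1))"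
    | (across) "v + 1 = seed_height u" "u + 1 < W" "d = West" "j = i" "\<kappa> = KLab (Seed (u + 1) 0)"
    | (out) "v + 1 = seed_height u" "u + 1 = W" "d = North" "j = i" "\<kappa> = KLab (Seg 0 (Inc True) None)"
    | (data) "v + 1 = seed_height u" "d = East" "u mod 4 = 0" "u > 0" "j = i" "\<kappa> = KDigit (digit_at 0 (k - u div 4))"
    using assms(3,4) by (auto split: if_splits)
  thus ?thesis
  proof cases
    case up
    hence "onward (i, 0, u, v) d j \<kappa>" using assms Q unfolding onward_def
      by (intro bexI[of _ "(i, 0, u, v + 1)"]) (auto simp: c0_def Seed_in_V)
    thus ?thesis ..
  next
    case across
    hence "onward (i, 0, u, v) d j \<kappa>" using assms Q seed_height_pos unfolding onward_def
      by (intro bexI[of _ "(i, 0, u + 1, 0)"]) (auto simp: c0_def Seed_in_V)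
    thus ?thesis ..
  next
    case out
    hence "W - Suc 0 = u" "seed_height u - Suc 0 = v" by auto
    hence "onward (i, 0, u, v) d j \<kappa>" using out assms Q seed_height_pos unfolding onward_def
      by (intro bexI[of _ "(i, 1, 0, 0)"]) (auto simp: c0_def Pass_in_V digit_opt_def mode_at_def)
    thus ?thesis ..
  next
    case data
    then obtain a where a: "u = 4 * a" "a > 0" "a \<le> k" using assms(2)
      by (cases u rule: mod4_cases) (auto simp: W_def mod_Suc)
    hence "feeds (i, 0, u, v) d j \<kappa>" using assms data Q unfolding feeds_def
      by (intro exI[of _ 1] exI[of _ "k - a"]) (auto simp: seed_height_simps heading_mode_at column_def)
    thus ?thesis ..
  qed
qed

lemma emission_Pass:
  assumes "i < 4" "1 \<le> p" "p \<le> Q" "s \<le> k" "e < 8" "s = k \<longrightarrow> e \<le> 5" "p = Q \<longrightarrow> e \<noteq> 2 \<and> e \<noteq> 3"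
    "emits i (label_of (i, p, s, e)) d = Some (j, \<kappa>)"
  shows "onward (i, p, s, e) d j \<kappa> \<or> feeds (i, p, s, e) d j \<kappa>"
proof -
  have Q: "Q \<noteq> 0" "Q \<ge> Suc 0" "even Q" using R by (auto simp: Q_def)
  note sm = Pass_in_V Seed_in_V c0_def heading_mode_at mode_at_Fin
  have on: "onward (i, p, s, e) d j \<kappa>"
    if "c' \<in> V" "c' \<noteq> c0" "pred_cell c' = (i, p, s, e)" "strip_of c' = j" "in_key (label_of c') = \<kappa>"
      "rot j (in_dir (label_of c')) = rot i d" for c'
    using that assms(1) unfolding onward_def by auto
  consider "e = 0" | "e = 1" "p \<noteq> Q" | "e = 1" "p = Q" "d = West" | "e = 1" "p = Q" "d \<noteq> West"
    | "e = 2" "d = heading (mode_at p s)" | "e = 2" "d \<noteq> heading (mode_at p s)" | "e = 3" | "e = 4"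
    | "e = 5" "s < k" | "e = 5" "s = k" "p < Q" | "e = 5" "s = k" "p = Q" | "e = 6" | "e = 7"
    using assms unfolding less8 by (metis le_neq_implies_less)
  thus ?thesis
  proof cases
    case 1
    thus ?thesis using assms by (intro disjI1 on[of "(i, p, s, 1)"]) (auto simp: sm split: if_splits)
  next
    case 2
    thus ?thesis using assms by (intro disjI1 on[of "(i, p, s, 2)"]) (auto simp: sm split: if_splits)
  next
    case 3
    thus ?thesis using assms Q by (intro disjI1 on[of "(i, p, s, 4)"]) (auto simp: sm split: if_splits)
  next
    case 4
    hence "j = 0" "\<kappa> = KLab Riser" "d = East" "i = 3" "s = 0" using assms
      by (auto simp: sm digit_opt_def split: if_splits)
    thus ?thesis using 4 W_less_M by (intro disjI1 on[of "(4, 0, W, W)"]) (auto simp: sm rot_simps)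
  next
    case 5
    thus ?thesis using assms by (intro disjI1 on[of "(i, p, s, 3)"]) (auto simp: sm split: if_splits)
  next
    case 6
    hence s: "s > 0" "j = i" "d = opp (heading (mode_at p s))" "\<kappa> = KDigit (digit_at p (column p s))"
      using assms by (auto simp: digit_opt_def split: if_splits)
    hence "feeds (i, p, s, e) d j \<kappa>" using 6 assms unfolding feeds_def
      by (intro exI[of _ "p + 1"] exI[of _ "k - s"]) (auto simp: heading_mode_at column_def)
    thus ?thesis ..
  next
    case 7
    thus ?thesis using assms by (intro disjI1 on[of "(i, p, s, 4)"]) (auto simp: sm split: if_splits)
  next
    case 8
    thus ?thesis using assms by (intro disjI1 on[of "(i, p, s, 5)"]) (auto simp: sm split: if_splits)
  next
    case 9
    thus ?thesis using assms last_seg_iff[of s p] by (intro disjI1 on[of "(i, p, s, 6)"]) (auto simp: sm split: if_splits)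
  next
    case 10
    have "turn i (mode_at p k) = Some (i, KLab (Seg 0 (mode_at (Suc p) 0) None))"
      using counter_overflow[of p] assms 10 by (auto simp: mode_at_def)
    thus ?thesis using 10 assms last_seg_iff[of s p]
      by (intro disjI1 on[of "(i, p + 1, 0, 0)"]) (auto simp: sm digit_opt_def split: if_splits)
  next
    case 11
    have "turn i (mode_at p k) = (if i < 3 then Some (i + 1, KLab (Seed 0 0)) else None)"
      using 11 Q by (auto simp: mode_at_def)
    hence "i < 3" "j = i + 1" "\<kappa> = KLab (Seed 0 0)" "d = North" using 11 assms last_seg_iff[of s p]
      by (auto split: if_splits)
    thus ?thesis using 11 assms W_less_M seed_height_pos
      by (intro disjI1 on[of "(i + 1, 0, 0, 0)"]) (auto simp: sm rot_Suc_West)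
  next
    case 12
    thus ?thesis using assms by (intro disjI1 on[of "(i, p, s, 7)"]) (auto simp: sm split: if_splits)
  next
    case 13
    thus ?thesis using assms step_mode_at[of p s]
      by (intro disjI1 on[of "(i, p, s + 1, 0)"]) (auto simp: sm digit_opt_def split: if_splits)
  qed
qed

lemma emission_Centre:
  assumes "W \<le> x" "x < M" "W \<le> y" "y < M" "emits 0 (if x = W then Riser else Filler) d = Some (j, \<kappa>)"
  shows "onward (4, 0, x, y) d j \<kappa> \<or> walled (4, 0, x, y) d"
proof -
  consider "x = W" "d = North" "j = 0" "\<kappa> = KLab Riser" | "d = East" "j = 0" "\<kappa> = KLab Filler"
    using assms(5) by (auto split: if_splits)
  thus ?thesis
  proof cases
    case 1
    show ?thesis
    proof (cases "y + 1 < M")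
      case True
      hence "onward (4, 0, x, y) d j \<kappa>" using 1 assms unfolding onward_def
        by (intro bexI[of _ "(4, 0, x, y + 1)"]) (auto simp: Seed_in_V c0_def rot_simps)
      thus ?thesis ..
    next
      case False
      thus ?thesis using wall[of "int W" "int M"] 1 assms by (auto simp: walled_def padd_def rot_simps)
    qed
  next
    case 2
    show ?thesis
    proof (cases "x + 1 < M")
      case True
      hence "onward (4, 0, x, y) d j \<kappa>" using 2 assms unfolding onward_def
        by (intro bexI[of _ "(4, 0, x + 1, y)"]) (auto simp: Seed_in_V c0_def rot_simps)
      thus ?thesis ..
    next
      case False
      thus ?thesis using wall[of "int M" "int y"] 2 assms by (auto simp: walled_def padd_def rot_simps)
    qed
  qed
qed

text \<open>An emitted glue points to the next cell of a path, to the reader of a digit, or from the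
  rim of the centre to the frame. This list bounds the places where anything can attach.\<close>

lemma emission:
  assumes "c \<in> V" "emits (strip_of c) (label_of c) d = Some (j, \<kappa>)"
  shows "onward c d j \<kappa> \<or> feeds c d j \<kappa> \<or> walled c d"
  using assms(1)
proof (cases rule: V_cases)
  case (Seed i u v)
  thus ?thesis using emission_Seed[of i u v d j \<kappa>] assms(2) by auto
next
  case (Pass i p s e)
  thus ?thesis using emission_Pass[of i p s e d j \<kappa>] assms(2) by (auto simp del: label_of.simps)
next
  case (Centre x y)
  thus ?thesis using emission_Centre[of x y d j \<kappa>] assms(2) by auto
qed

end

section \<open>Determinism\<close>

definition sglue_str :: "sglue option \<Rightarrow> sglue option \<Rightarrow> int" where
  "sglue_str g h = (case g of None \<Rightarrow> 0 | Some a \<Rightarrow> if h = Some a then (if a = Neg then - 1 else 1) else 0)"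

lemma glue_str_enc: "glue_str (map_option enc g) (map_option enc h) = sglue_str g h"
proof (cases g)
  case (Some a)
  have "(map_option enc h = Some (enc a)) = (h = Some a)" by (cases h) (auto simp: enc_inj)
  thus ?thesis using Some by (cases a) (auto simp: glue_str_def sglue_str_def)
qed (simp add: glue_str_def sglue_str_def)

lemma sglue_str_pos: "sglue_str g h > 0 \<Longrightarrow> \<exists>\<delta> j \<kappa>. g = Some (Pos \<delta> j \<kappa>) \<and> h = g"
  by (auto simp: sglue_str_def split: option.splits if_splits) (metis sglue.exhaust)

lemma sglue_str_neg: "sglue_str g h < 0 \<Longrightarrow> g = Some Neg \<and> h = g"
  by (auto simp: sglue_str_def split: option.splits if_splits)

lemma sglue_str_le: "sglue_str g h \<le> 1" by (auto simp: sglue_str_def split: option.splits)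

lemma padd_opp: "padd (padd z (dvec d)) (dvec (opp d)) = z" "padd (padd z (dvec (opp d))) (dvec d) = z"
  by (cases d; simp add: padd_def)+

lemma in_key_KLab: "in_key l = KLab l' \<longleftrightarrow> l = l' \<and> (\<forall>m D. l \<noteq> Reader m D)" by (cases l) auto
lemma in_key_KRead: "in_key l = KRead m \<longleftrightarrow> (\<exists>D. l = Reader m D)" by (cases l) auto
lemma in_key_KDigit: "in_key l \<noteq> KDigit D" by (cases l) auto

text \<open>The sides are listed by their role for a reader: announcement, guard, output,
  digit.\<close>

lemma sum_dirs:
  fixes f :: "dir \<Rightarrow> int"
  assumes "i < 4"
  shows "(\<Sum>D\<in>{North, East, South, West}. f D)
    = f (rot i North) + f (rot i South) + f (rot i (heading m)) + f (rot i (opp (heading m)))"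
  using assms unfolding less4 by (cases m) (auto simp: rot_simps)

lemma sum_dirs_ge:
  fixes f :: "dir \<Rightarrow> int"
  assumes "\<And>D. f D \<ge> 0" "f D0 \<ge> 1"
  shows "(\<Sum>D\<in>{North, East, South, West}. f D) \<ge> 1"
  using assms(1)[of North] assms(1)[of East] assms(1)[of South] assms(1)[of West] assms(2)
  by (cases D0) auto

lemma sum_dirs_pos:
  fixes f :: "dir \<Rightarrow> int"
  assumes "(\<Sum>D\<in>{North, East, South, West}. f D) \<ge> 1"
  obtains D where "f D > 0"
proof (rule ccontr)
  assume "\<not> thesis"
  hence "f D \<le> 0" for D using that[of D] by force
  from this[of North] this[of East] this[of South] this[of West] show False using assms by auto
qed

context strips
begin

section \<open>The finite tile set and the consistency of its sides\<close>

definition digits :: "digit set" where "digits = {..<b} \<times> UNIV \<times> UNIV"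
definition modes :: "mode set" where "modes = {Inc True, Inc False, Copy, Fin}"

definition labs :: "lab set" where
  "labs = (\<lambda>(u, v). Seed u v) ` ({..<W} \<times> {..H})
     \<union> (\<lambda>(e, m, Do). Seg e m Do) ` ({..<6} \<times> modes \<times> (insert None (Some ` digits)))
     \<union> Guard ` modes \<union> (\<lambda>(m, D). Reader m D) ` (modes \<times> digits) \<union> {Riser, Filler}"

definition lab_tile :: "nat \<Rightarrow> lab \<Rightarrow> tile" where "lab_tile i l D = map_option enc (side i l D)"

definition tiles :: "tile set" where "tiles = (\<lambda>(i, l). lab_tile i l) ` ({..<4} \<times> labs)"

definition cell_tile :: "cell \<Rightarrow> tile" where "cell_tile c = lab_tile (strip_of c) (label_of c)"

lemma digit_at_digits: "digit_at p c \<in> digits" using b by (auto simp: digit_at_def digits_def)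

lemma mode_at_modes: "mode_at p s \<in> modes" by (cases "b ^ s dvd counter p") (auto simp: mode_at_def modes_def)

lemma strip_of_less: "strip_of c < 4" by (cases c) auto

lemma labs_mem:
  "Seed u v \<in> labs \<longleftrightarrow> u < W \<and> v \<le> H"
  "Seg e m Do \<in> labs \<longleftrightarrow> e < 6 \<and> m \<in> modes \<and> Do \<in> insert None (Some ` digits)"
  "Guard m \<in> labs \<longleftrightarrow> m \<in> modes" "Reader m D \<in> labs \<longleftrightarrow> m \<in> modes \<and> D \<in> digits"
  "Riser \<in> labs" "Filler \<in> labs"
  by (auto simp: labs_def image_iff)

lemma label_of_labs:
  assumes "c \<in> V"
  shows "label_of c \<in> labs"
  using assms
proof (cases rule: V_cases)
  case (Seed i u v)
  moreover have "seed_height u \<le> H + 1" by (simp add: seed_height_def)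
  ultimately show ?thesis by (auto simp: labs_mem)
next
  case (Pass i p s e)
  consider "e \<le> 5" | "e = 6" | "e = 7" using Pass by linarith
  thus ?thesis
  proof cases
    case 1
    have "digit_opt p s \<in> insert None (Some ` digits)" using digit_at_digits by (auto simp: digit_opt_def)
    thus ?thesis using Pass 1 mode_at_modes by (auto simp: labs_mem)
  qed (use Pass digit_at_digits mode_at_modes in \<open>auto simp: labs_mem\<close>)
qed (auto simp: labs_mem)

text \<open>In the seed, \<open>W - 1\<close> is even, so the last column is traversed upwards and
  can be left at its top; and digit columns have height at least 2, so the cell entered from the
  east is not the one that shows its digit to the east.\<close>

lemma emits_not_receives: "l \<in> labs \<Longrightarrow> emits i l d = Some z \<Longrightarrow> receives l d = None"
proof (cases l)
  case (Seed u v)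
  have "even (W - 1)" by (simp add: W_def)
  hence "even u" if "u + 1 = W" by (simp flip: that)
  moreover have "seed_height u > 1" if "u mod 4 = 0" using that H by (auto simp: seed_height_def)
  moreover have "even u" if "u mod 4 = 0" using that by presburger
  moreover assume "emits i l d = Some z"
  ultimately show ?thesis using Seed by (auto simp: receives_def split: if_splits)
next
  case (Seg e m Do)
  assume "l \<in> labs" "emits i l d = Some z"
  moreover from this Seg have "e < 6" by (simp add: labs_mem)
  moreover have "heading m = East \<or> heading m = West" by (cases m) auto
  ultimately show ?thesis using Seg by (auto simp: receives_def split: if_splits)
next
  case (Guard m)
  have "heading m = East \<or> heading m = West" by (cases m) auto
  moreover assume "emits i l d = Some z"
  ultimately show ?thesis using Guard by (auto simp: receives_def split: if_splits)
next
  case (Reader m D)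
  have "heading m = East \<or> heading m = West" by (cases m) auto
  moreover assume "emits i l d = Some z"
  ultimately show ?thesis using Reader by (auto simp: receives_def split: if_splits)
qed (auto simp: receives_def split: if_splits)

lemma neg_side_not_used: "neg_side l d \<Longrightarrow> receives l d = None \<and> emits i l d = None"
proof (cases l)
  case (Seed u v)
  assume "neg_side l d"
  moreover from this Seed have "u mod 4 = 3" by simp
  hence "odd u" by presburger
  moreover from this have "Suc u \<noteq> W" unfolding W_def by presburger
  ultimately show ?thesis using Seed by (auto simp: receives_def)
next
  case (Guard m)
  have "heading m = East \<or> heading m = West" by (cases m) auto
  moreover assume "neg_side l d"
  ultimately show ?thesis using Guard by (auto simp: receives_def)
next
  case (Reader m D)
  have "heading m = East \<or> heading m = West" by (cases m) auto
  moreover assume "neg_side l d"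
  ultimately show ?thesis using Reader by (auto simp: receives_def)
qed auto

lemma side_Neg: "i < 4 \<Longrightarrow> neg_side l d \<Longrightarrow> side i l (rot i d) = Some Neg"
  using neg_side_not_used[of l d i] by (simp add: side_def unrot_rot)

lemma side_NegD: "side i l D = Some Neg \<Longrightarrow> neg_side l (unrot i D)"
  by (auto simp: side_def split: option.splits if_splits)

lemma side_receives: "i < 4 \<Longrightarrow> receives l d = Some \<kappa> \<Longrightarrow> side i l (rot i d) = Some (Pos (opp (rot i d)) i \<kappa>)"
  by (simp add: side_def unrot_rot)

lemma side_emits: "i < 4 \<Longrightarrow> l \<in> labs \<Longrightarrow> emits i l d = Some (j, \<kappa>) \<Longrightarrow> side i l (rot i d) = Some (Pos (rot i d) j \<kappa>)"
  using emits_not_receives by (simp add: side_def unrot_rot)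

lemma side_PosD: "side i l D = Some (Pos \<delta> j \<kappa>) \<Longrightarrow>
    (\<delta> = opp D \<and> j = i \<and> receives l (unrot i D) = Some \<kappa>) \<or> (\<delta> = D \<and> emits i l (unrot i D) = Some (j, \<kappa>))"
  by (auto simp: side_def split: option.splits if_splits)

sublocale growth V cell_pos cell_tile pred_cell c0 tiles "{(c, d). cell_less c d}"
proof
  show "finite V" by (rule finite_V)
  show "inj_on cell_pos V" by (rule cell_pos_inj)
  show "c0 \<in> V" by (rule c0_in_V)
  show "wf {(c, d). cell_less c d}" by (rule wf_cell_less)
  show "(pred_cell c, c) \<in> {(c, d). cell_less c d}" if "c \<in> V" "c \<noteq> c0" for c
    using link_pred_cell[OF that] by (auto simp: link_def)
  show "pred_cell c \<in> V" if "c \<in> V" "c \<noteq> c0" for c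
    using link_pred_cell[OF that] by (auto simp: link_def)
  show "cell_tile c \<in> tiles" if "c \<in> V" for c
    using label_of_labs[OF that] strip_of_less[of c] by (auto simp: cell_tile_def tiles_def)
qed

abbreviation down :: "cell set \<Rightarrow> bool" where "down \<equiv> down_closed V pred_cell c0"

section \<open>Bonds at an empty position\<close>

definition side_strength :: "cell set \<Rightarrow> pos \<Rightarrow> nat \<Rightarrow> lab \<Rightarrow> dir \<Rightarrow> int" where
  "side_strength A x i l D = (case asm A (padd x (dvec D)) of None \<Rightarrow> 0 | Some t' \<Rightarrow> glue_str (lab_tile i l D) (t' (opp D)))"

lemma bind_strength_sum: "bind_strength (asm A) x (lab_tile i l) = (\<Sum>D\<in>{North, East, South, West}. side_strength A x i l D)"
  by (simp add: bind_strength_def side_strength_def)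

lemma downD:
  "down A \<Longrightarrow> A \<subseteq> V"
  "down A \<Longrightarrow> c \<in> A \<Longrightarrow> c \<noteq> c0 \<Longrightarrow> pred_cell c \<in> A"
  "down A \<Longrightarrow> c0 \<in> A"
  by (auto simp: down_closed_def)

lemma side_strength_eq:
  assumes "down A" "c \<in> A" "cell_pos c = padd x (dvec D)"
  shows "side_strength A x i l D = sglue_str (side i l D) (side (strip_of c) (label_of c) (opp D))"
proof -
  have "asm A (padd x (dvec D)) = Some (cell_tile c)"
    using asm_pos[of A c] downD(1)[OF assms(1)] assms(2,3) by auto
  thus ?thesis by (simp add: side_strength_def cell_tile_def lab_tile_def glue_str_enc)
qed

lemma side_strength_cases:
  assumes "down A"
  obtains "side_strength A x i l D = 0"
  | c where "c \<in> A" "cell_pos c = padd x (dvec D)" "side_strength A x i l D = sglue_str (side i l D) (side (strip_of c) (label_of c) (opp D))"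
proof (cases "asm A (padd x (dvec D))")
  case None
  thus ?thesis using that(1) by (simp add: side_strength_def)
next
  case (Some t)
  then obtain c where "c \<in> A" "padd x (dvec D) = cell_pos c" using asm_SomeD downD(1)[OF assms] by metis
  thus ?thesis using that(2) side_strength_eq[OF assms] by metis
qed

lemma side_strength_le: "down A \<Longrightarrow> side_strength A x i l D \<le> 1"
  by (rule side_strength_cases[of A x i l D]) (simp_all add: sglue_str_le)

lemma label_of_ReaderE:
  assumes "c \<in> V" "label_of c = Reader m D"
  obtains i p s where "c = (i, p, s, 7)" "i < 4" "1 \<le> p" "p \<le> Q" "s < k" "m = mode_at p s"
    "D = digit_at (p - 1) (column p (s + 1))" "strip_of c = i"
  using assms(1)
proof (cases rule: V_cases)
  case (Pass i p s e)
  hence "e = 7" using assms(2) by (auto split: if_splits)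
  thus ?thesis using Pass assms(2) by (intro that[of i p s]) auto
qed (use assms(2) in \<open>auto split: if_splits\<close>)

text \<open>A placed tile has its source beside it: its predecessor by closure, the digit of a
  reader by \<open>prefix\<close>. The seed is the exception, as its entry glue has no
  source.\<close>

lemma received:
  assumes "down A" "c \<in> A" "receives (label_of c) d = Some \<kappa>"
  shows "(\<exists>c'\<in>A. cell_pos c' = padd (cell_pos c) (dvec (rot (strip_of c) d))) \<or> (strip_of c = 0 \<and> \<kappa> = KLab (Seed 0 0))"
proof (cases "d = opp (in_dir (label_of c))")
  case True
  show ?thesis
  proof (cases "c = c0")
    case c: True
    thus ?thesis using assms(3) True by (auto simp: receives_def c0_def)
  next
    case False
    have "c \<in> V" using assms downD by blast
    hence "cell_pos c = padd (cell_pos (pred_cell c)) (dvec (rot (strip_of c) (in_dir (label_of c))))"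
      using link_pred_cell[of c] False by (simp add: link_def)
    hence "cell_pos (pred_cell c) = padd (cell_pos c) (dvec (rot (strip_of c) d))" using True by (simp add: rot_opp padd_opp)
    thus ?thesis using downD(2)[OF assms(1,2) False] by blast
  qed
next
  case False
  then obtain m D where l: "label_of c = Reader m D" "d = opp (heading m)"
    using assms(3) by (auto simp: receives_def split: lab.splits if_splits)
  have "c \<in> V" using assms downD by blast
  then obtain i p s where c: "c = (i, p, s, 7)" "i < 4" "1 \<le> p" "p \<le> Q" "s < k" "m = mode_at p s" "strip_of c = i"
    using l(1) by (rule label_of_ReaderE)
  note r = reader[OF c(2-5,1)]
  have "digit_cell c \<in> A" using prefix[OF assms(1,2) _ r(4,6)] c by simp
  thus ?thesis using r(15) l c by metis
qed

text \<open>A match on an emitting side would make the neighbour receive from \<open>x\<close>; by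
  \<open>received\<close> a tile would then already be at \<open>x\<close>. In the remaining case
  the neighbour waits for \<open>Seed 0 0\<close> in strip 0, which no tile emits.\<close>

lemma emits_nonpos:
  assumes "down A" "x \<notin> cell_pos ` A" "side i l D = Some (Pos D j \<kappa>)"
  shows "side_strength A x i l D \<le> 0"
proof (rule ccontr)
  assume "\<not> ?thesis"
  then obtain c where c: "c \<in> A" "cell_pos c = padd x (dvec D)" "sglue_str (side i l D) (side (strip_of c) (label_of c) (opp D)) > 0"
    using side_strength_cases[OF assms(1), of x i l D] by (metis linorder_not_le order_refl)
  hence "side (strip_of c) (label_of c) (opp D) = Some (Pos D j \<kappa>)" using sglue_str_pos[OF c(3)] assms(3) by auto
  from side_PosD[OF this] have r: "j = strip_of c" "receives (label_of c) (unrot (strip_of c) (opp D)) = Some \<kappa>"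
    by (auto simp: opp_neq)
  have e: "emits i l (unrot i D) = Some (j, \<kappa>)" using side_PosD[OF assms(3)] by (auto simp: opp_neq)
  have "rot (strip_of c) (unrot (strip_of c) (opp D)) = opp D" using rot_unrot strip_of_less by blast
  with received[OF assms(1) c(1) r(2)] consider c' where "c' \<in> A" "cell_pos c' = x" | "j = 0" "\<kappa> = KLab (Seed 0 0)"
    using c(2) r(1) by (auto simp: padd_opp)
  thus False
  proof cases
    case 2
    have "turn i m \<noteq> Some (0, KLab (Seed 0 0))" for m by (cases m) auto
    thus ?thesis using e 2 by (cases l) (auto split: if_splits)
  qed (use assms(2) in auto)
qed

text \<open>The match is traced back to the emitting neighbour and its target. A walled emission is
  impossible: a tile in the centre implies the port, the port implies the wall, and so
  \<open>x\<close> would be occupied.\<close>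

lemma receiver_cell:
  assumes "down A" "x \<notin> cell_pos ` A" "side i l D = Some (Pos (opp D) i \<kappa>)" "side_strength A x i l D > 0"
  shows "(\<exists>c\<in>V. cell_pos c = x \<and> pred_cell c \<in> A \<and> c \<noteq> c0 \<and> strip_of c = i \<and> in_key (label_of c) = \<kappa>) \<or>
    (\<exists>p s. i < 4 \<and> 1 \<le> p \<and> p \<le> Q \<and> s < k \<and> cell_pos (i, p, s, 7) = x \<and> digit_cell (i, p, s, 7) \<in> A \<and>
      \<kappa> = KDigit (digit_at (p - 1) (column p (s + 1))))"
proof -
  obtain c where c: "c \<in> A" "cell_pos c = padd x (dvec D)" "sglue_str (side i l D) (side (strip_of c) (label_of c) (opp D)) > 0"
    using assms(4) side_strength_cases[OF assms(1), of x i l D] by (metis less_irrefl)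
  hence "side (strip_of c) (label_of c) (opp D) = Some (Pos (opp D) i \<kappa>)" using sglue_str_pos[OF c(3)] assms(3) by auto
  from side_PosD[OF this] have e: "emits (strip_of c) (label_of c) (unrot (strip_of c) (opp D)) = Some (i, \<kappa>)"
    by (auto simp: opp_neq)
  have cV: "c \<in> V" using c(1) downD(1)[OF assms(1)] by blast
  have d: "rot (strip_of c) (unrot (strip_of c) (opp D)) = opp D" using rot_unrot strip_of_less by blast
  from emission[OF cV e] consider (on) "onward c (unrot (strip_of c) (opp D)) i \<kappa>"
    | (fd) "feeds c (unrot (strip_of c) (opp D)) i \<kappa>" | (wl) "walled c (unrot (strip_of c) (opp D))" by blast
  thus ?thesis
  proof cases
    case on
    then obtain c' where c': "c' \<in> V" "c' \<noteq> c0" "pred_cell c' = c" "strip_of c' = i" "in_key (label_of c') = \<kappa>"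
      "rot (strip_of c') (in_dir (label_of c')) = opp D" unfolding onward_def d by blast
    have "cell_pos c' = x" using link_pred_cell[OF c'(1,2)] c' c(2) by (simp add: link_def padd_opp)
    thus ?thesis using c' c(1) by blast
  next
    case fd
    then obtain p s where ps: "i < 4" "1 \<le> p" "p \<le> Q" "s < k" "digit_cell (i, p, s, 7) = c"
      "unrot (strip_of c) (opp D) = heading (mode_at p s)" "\<kappa> = KDigit (digit_at (p - 1) (column p (s + 1)))"
      unfolding feeds_def by blast
    note r = reader[OF ps(1-4) refl]
    have "strip_of c = i" using r(9) ps(5) by simp
    hence "rot i (heading (mode_at p s)) = opp D" using d ps(6) by simp
    hence "cell_pos (i, p, s, 7) = x" using r(15) c(2) ps(5) by (metis opp_opp padd_opp(2) rot_opp)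
    thus ?thesis using ps c(1) by blast
  next
    case wl
    then obtain c' where c': "\<not> fst c < 4" "c' \<in> V" "fst c' < 4" "cell_less c' (3, Q, 0, 1)"
      "cell_pos c' = padd (cell_pos c) (dvec (opp D))" unfolding walled_def d by blast
    have "(3, Q, 0, 1) \<in> A" using centre_port[OF assms(1) c(1) c'(1)] .
    hence "c' \<in> A" using prefix[OF assms(1) _ _ c'(2,4)] by simp
    thus ?thesis using assms(2) c'(5) c(2) by (metis imageI padd_opp(1))
  qed
qed

text \<open>Only receiving sides contribute. For an ordinary tile the incoming key is the whole
  label, so one match identifies it. For a reader, either positive match puts \<open>x\<close> into
  a notch whose guard is present; the guard subtracts 1, so announcement and digit must both match,
  the one fixing the mode and the other the digit.\<close>

lemma attach_determined:
  assumes D: "down A" and x: "x \<notin> cell_pos ` A" and t: "t \<in> tiles" and bs: "bind_strength (asm A) x t \<ge> 1"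
  shows "\<exists>c\<in>V. cell_pos c = x \<and> cell_tile c = t \<and> pred_cell c \<in> A"
proof -
  obtain i l where il: "i < 4" "l \<in> labs" "t = lab_tile i l" using t by (auto simp: tiles_def)
  have sum: "(\<Sum>D\<in>{North, East, South, West}. side_strength A x i l D) \<ge> 1" using bs il(3) bind_strength_sum by simp
  have pos: "\<exists>\<kappa>. side i l D = Some (Pos (opp D) i \<kappa>) \<and> receives l (unrot i D) = Some \<kappa>" if p: "side_strength A x i l D > 0" for D
  proof -
    obtain c where c: "sglue_str (side i l D) (side (strip_of c) (label_of c) (opp D)) > 0"
      using p side_strength_cases[OF D, of x i l D] by (metis less_irrefl)
    then obtain \<delta> j \<kappa> where g: "side i l D = Some (Pos \<delta> j \<kappa>)" using sglue_str_pos by blast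
    have "\<delta> \<noteq> D" using emits_nonpos[OF D x, of i l D j \<kappa>] g p by auto
    thus ?thesis using side_PosD[OF g] g by auto
  qed
  show ?thesis
  proof (cases "\<exists>m Dt. l = Reader m Dt")
    case False
    obtain D' where D': "side_strength A x i l D' > 0" using sum sum_dirs_pos by blast
    obtain \<kappa> where \<kappa>: "side i l D' = Some (Pos (opp D') i \<kappa>)" "receives l (unrot i D') = Some \<kappa>" using pos[OF D'] by blast
    have "\<kappa> = KLab l" using \<kappa>(2) False by (cases l) (auto simp: receives_def split: if_splits)
    then obtain c where "c \<in> V" "cell_pos c = x" "pred_cell c \<in> A" "strip_of c = i" "label_of c = l"
      using receiver_cell[OF D x \<kappa>(1) D'] by (auto simp: in_key_KLab)
    thus ?thesis using il by (auto simp: cell_tile_def)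
  next
    case True
    then obtain m Dt where l: "l = Reader m Dt" by blast
    let ?f = "side_strength A x i l"
    have fm: "heading m = East \<or> heading m = West" by (cases m) auto
    have neg_side: "side i l (rot i South) = Some Neg" using il l by (intro side_Neg) auto
    have inn: "side i l (rot i North) = Some (Pos (opp (rot i North)) i (KRead m))"
      using il l by (intro side_receives) (auto simp: receives_def)
    have dat: "side i l (rot i (opp (heading m))) = Some (Pos (opp (rot i (opp (heading m)))) i (KDigit Dt))"
      using il l fm by (intro side_receives) (auto simp: receives_def)
    have out: "?f (rot i (heading m)) \<le> 0"
      by (rule emits_nonpos[OF D x side_emits]) (use il l fm in \<open>auto simp: receives_def\<close>)
    have nonpos: "?f (rot i South) \<le> 0" using pos[of "rot i South"] neg_side by force
    have S: "?f (rot i North) + ?f (rot i South) + ?f (rot i (heading m)) + ?f (rot i (opp (heading m))) \<ge> 1"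
      using sum sum_dirs[OF il(1), of ?f m] by simp
    have in_cell: "\<exists>c\<in>V. cell_pos c = x \<and> pred_cell c \<in> A \<and> c \<noteq> c0 \<and> strip_of c = i \<and> (\<exists>D'. label_of c = Reader m D')"
      if "?f (rot i North) > 0"
      using receiver_cell[OF D x inn that] by (auto simp: in_key_KRead)
    have data_cell: "\<exists>p s. 1 \<le> p \<and> p \<le> Q \<and> s < k \<and> cell_pos (i, p, s, 7) = x \<and> digit_cell (i, p, s, 7) \<in> A \<and>
        Dt = digit_at (p - 1) (column p (s + 1))" if "?f (rot i (opp (heading m))) > 0"
      using receiver_cell[OF D x dat that] in_key_KDigit unfolding key.inject by blast
    have rdr: "\<exists>p s. 1 \<le> p \<and> p \<le> Q \<and> s < k \<and> cell_pos (i, p, s, 7) = x \<and> digit_cell (i, p, s, 7) \<in> A"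
    proof (cases "?f (rot i (opp (heading m))) > 0")
      case True
      thus ?thesis using data_cell by blast
    next
      case False
      hence "?f (rot i North) > 0" using S out nonpos by linarith
      then obtain c D' where c: "c \<in> V" "cell_pos c = x" "pred_cell c \<in> A" "c \<noteq> c0" "strip_of c = i" "label_of c = Reader m D'"
        using in_cell by blast
      obtain p s where ps: "c = (i, p, s, 7)" "1 \<le> p" "p \<le> Q" "s < k"
        using c(5) by (rule_tac label_of_ReaderE[OF c(1,6)]) auto
      note r = reader[OF il(1) ps(2-4,1)]
      have "digit_cell c \<in> A" using prefix[OF D c(3) _ r(4,7)] ps il(1) by simp
      thus ?thesis using ps c by blast
    qed
    then obtain p s where ps: "1 \<le> p" "p \<le> Q" "s < k" "cell_pos (i, p, s, 7) = x" "digit_cell (i, p, s, 7) \<in> A" by blast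
    note r = reader[OF il(1) ps(1-3) refl]
    have gA: "guard_cell (i, p, s, 7) \<in> A"
      using prefix[OF D ps(5) _ r(3,5)] il(1) r(10) by metis
    have "side i (label_of (guard_cell (i, p, s, 7))) (opp (rot i South)) = Some Neg"
      using side_Neg[OF il(1) r(12)] by (simp add: rot_opp[symmetric])
    hence "?f (rot i South) = - 1"
      using side_strength_eq[OF D gA, of x "rot i South" i l] r(14,8) ps(4) neg_side by (simp add: sglue_str_def)
    moreover have "?f (rot i North) \<le> 1" "?f (rot i (opp (heading m))) \<le> 1" using side_strength_le[OF D] by blast+
    ultimately have both: "?f (rot i North) > 0" "?f (rot i (opp (heading m))) > 0" using S out by linarith+
    obtain c D' where c: "c \<in> V" "cell_pos c = x" "pred_cell c \<in> A" "strip_of c = i" "label_of c = Reader m D'"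
      using in_cell[OF both(1)] by blast
    obtain p' s' where q: "1 \<le> p'" "p' \<le> Q" "s' < k" "cell_pos (i, p', s', 7) = x" "Dt = digit_at (p' - 1) (column p' (s' + 1))"
      using data_cell[OF both(2)] by blast
    note r' = reader[OF il(1) q(1-3) refl]
    \<comment> \<open>The cell announced by the path and the cell fed by the digit share the
      position \<open>x\<close>, so they coincide and the digit is the right one.\<close>
    have "c = (i, p', s', 7)" using c(1,2) r'(1) q(4) by (intro inj_onD[OF cell_pos_inj]) simp_all
    hence "label_of c = l" using c(5) r'(2) q(5) l by simp
    thus ?thesis using c il by (auto simp: cell_tile_def)
  qed
qed

text \<open>What faces the negative side of a guard is a reader of the next pass, which comes later;
  so a guard is never repelled when it is placed.\<close>

lemma guard_reader:
  assumes "c \<in> V" "neg_side (label_of c) d" "\<And>m D. label_of c \<noteq> Reader m D"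
  obtains c' where "c' \<in> V" "fst c' < 4" "d = North" "cell_less c c'" "cell_pos c' = padd (cell_pos c) (dvec (rot (strip_of c) North))"
proof -
  have "\<exists>i p s. i < 4 \<and> 1 \<le> p \<and> p \<le> Q \<and> s < k \<and> guard_cell (i, p, s, 7) = c \<and> d = North"
    using assms(1)
  proof (cases rule: V_cases)
    case (Seed i u v)
    then obtain a where "u = 4 * a + 3" using assms(2) by (cases u rule: mod4_cases) (auto simp: mod_Suc)
    moreover have "1 \<le> Q" using R by (simp add: Q_def)
    ultimately show ?thesis using Seed assms(2)
      by (intro exI[of _ i] exI[of _ 1] exI[of _ "k - 1 - a"]) (auto simp: W_def)
  next
    case (Pass i p s e)
    have "e \<noteq> 7" using assms(3)[of "mode_at p s" "digit_at (p - 1) (column p (s + 1))"] Pass by auto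
    hence "e = 6" using Pass assms(2) by (auto split: if_splits)
    moreover from this have "p < Q" "s < k" "d = North" using Pass assms(2) by (auto simp: mode_at_Fin)
    ultimately show ?thesis using Pass
      by (intro exI[of _ i] exI[of _ "p + 1"] exI[of _ "k - 1 - s"]) auto
  qed (use assms(2) in \<open>auto split: if_splits\<close>)
  then obtain i p s where ps: "i < 4" "1 \<le> p" "p \<le> Q" "s < k" "guard_cell (i, p, s, 7) = c" "d = North" by blast
  note r = reader[OF ps(1-4) refl]
  have "cell_less c (i, p, s, 7)"
    using r(5,6) ps(5) by (cases "digit_cell (i, p, s, 7)"; cases c) auto
  moreover have "cell_pos (i, p, s, 7) = padd (cell_pos c) (dvec (rot (strip_of c) North))"
    using r(14,8) ps(5) by (metis opp.simps(1) padd_opp(2) rot_opp)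
  ultimately show ?thesis using that r(1) ps by simp
qed

text \<open>The predecessor contributes 1. An ordinary tile meets no repulsion at that moment. A
  reader gains 1 more from the digit and loses at most 1 to the guard.\<close>

lemma attach_possible:
  assumes D: "down A" and c: "c \<in> V" "c \<notin> A" "pred_cell c \<in> A"
  shows "bind_strength (asm A) (cell_pos c) (cell_tile c) \<ge> 1"
proof -
  let ?i = "strip_of c" and ?l = "label_of c"
  let ?f = "side_strength A (cell_pos c) ?i ?l"
  have c0: "c \<noteq> c0" using c downD(3)[OF D] by auto
  note i4 = strip_of_less[of c]
  have lk: "link (pred_cell c) c" using link_pred_cell[OF c(1) c0] .
  then obtain d where d: "rot (strip_of (pred_cell c)) d = rot ?i (in_dir ?l)"
    "emits (strip_of (pred_cell c)) (label_of (pred_cell c)) d = Some (?i, in_key ?l)"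
    and pV: "pred_cell c \<in> V" and gp: "cell_pos c = padd (cell_pos (pred_cell c)) (dvec (rot ?i (in_dir ?l)))"
    by (auto simp: link_def)
  have e: "side (strip_of (pred_cell c)) (label_of (pred_cell c)) (rot ?i (in_dir ?l)) = Some (Pos (rot ?i (in_dir ?l)) ?i (in_key ?l))"
    using side_emits[OF strip_of_less label_of_labs[OF pV] d(2)] d(1) by simp
  have "side ?i ?l (rot ?i (opp (in_dir ?l))) = Some (Pos (rot ?i (in_dir ?l)) ?i (in_key ?l))"
    using side_receives[OF i4, of ?l "opp (in_dir ?l)" "in_key ?l"] by (simp add: receives_def rot_opp opp_opp)
  moreover have "cell_pos (pred_cell c) = padd (cell_pos c) (dvec (rot ?i (opp (in_dir ?l))))" using gp by (simp add: rot_opp padd_opp)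
  ultimately have in1: "?f (rot ?i (opp (in_dir ?l))) = 1"
    using side_strength_eq[OF D c(3)] e by (simp add: sglue_str_def rot_opp opp_opp)
  have neg_side: "neg_side ?l (unrot ?i D)" if "?f D < 0" for D
    using that by (cases rule: side_strength_cases[OF D, of "cell_pos c" ?i ?l D]) (auto dest: sglue_str_neg side_NegD)
  show ?thesis
  proof (cases "\<exists>m Dt. ?l = Reader m Dt")
    case False
    have "?f D \<ge> 0" for D
    proof (rule ccontr)
      assume n: "\<not> ?f D \<ge> 0"
      hence "neg_side ?l (unrot ?i D)" using neg_side by simp
      then obtain c' where c': "c' \<in> V" "fst c' < 4" "unrot ?i D = North" "cell_less c c'"
        "cell_pos c' = padd (cell_pos c) (dvec (rot ?i North))"
        using guard_reader[OF c(1)] False by metis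
      have "rot ?i North = D" using c'(3) rot_unrot[OF i4, of D] by simp
      moreover obtain c'' where "c'' \<in> A" "cell_pos c'' = padd (cell_pos c) (dvec D)"
        using n side_strength_cases[OF D, of "cell_pos c" ?i ?l D] by (metis order_refl)
      ultimately have "c' \<in> A" using c'(1,5) cell_pos_inj downD(1)[OF D] by (metis inj_onD subsetD)
      thus False using prefix[OF D _ c'(2) c(1) c'(4)] c(2) by blast
    qed
    thus ?thesis using sum_dirs_ge[of ?f "rot ?i (opp (in_dir ?l))"] in1 by (simp add: cell_tile_def bind_strength_sum)
  next
    case True
    then obtain m Dt where l: "?l = Reader m Dt" by blast
    obtain i p s where ps: "c = (i, p, s, 7)" "i < 4" "1 \<le> p" "p \<le> Q" "s < k" "m = mode_at p s"
      "Dt = digit_at (p - 1) (column p (s + 1))" "strip_of c = i" using c(1) l by (rule label_of_ReaderE)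
    note r = reader[OF ps(2-5,1)]
    have fm: "heading m = East \<or> heading m = West" by (cases m) auto
    have dA: "digit_cell c \<in> A" using prefix[OF D c(3) _ r(4,7)] ps(1,2) by simp
    have "side i (label_of (digit_cell c)) (rot i (heading m)) = Some (Pos (rot i (heading m)) i (KDigit Dt))"
      using side_emits[OF ps(2) label_of_labs[OF r(4)]] r(13) ps(6,7) by simp
    moreover have "side i ?l (rot i (opp (heading m))) = Some (Pos (opp (rot i (opp (heading m)))) i (KDigit Dt))"
      using l ps(2) fm by (intro side_receives) (auto simp: receives_def)
    ultimately have "?f (rot i (opp (heading m))) = 1"
      using side_strength_eq[OF D dA, of "cell_pos c" "rot i (opp (heading m))"] r(15,9) ps(6,8)
      by (simp add: sglue_str_def rot_opp opp_opp)
    moreover have "?f (rot i North) = 1" using in1 l ps(8) by simp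
    moreover have "?f (rot i South) \<ge> - 1"
      by (cases rule: side_strength_cases[OF D, of "cell_pos c" ?i ?l "rot i South"]) (auto simp: sglue_str_def split: option.splits)
    moreover have "?f (rot i (heading m)) \<ge> 0"
    proof (rule ccontr)
      assume "\<not> ?thesis"
      hence "neg_side ?l (unrot i (rot i (heading m)))" using neg_side ps(8) by auto
      thus False using l fm ps(2) by (auto simp: unrot_rot)
    qed
    ultimately show ?thesis using sum_dirs[OF ps(2), of ?f m] by (simp add: cell_tile_def bind_strength_sum)
  qed
qed

section \<open>Glue restriction and size of the tile set\<close>

lemma rg_tiles: "rg_tileset tiles"
proof -
  have "finite digits" by (auto simp: digits_def)
  moreover have "finite modes" by (auto simp: modes_def)
  ultimately have "finite labs" by (auto simp: labs_def)
  hence "finite tiles" by (auto simp: tiles_def)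
  moreover have coded: "\<exists>a. g = enc a" if "g \<in> glues_of tiles" for g
  proof -
    obtain t D where "t \<in> tiles" "t D = Some g" using \<open>g \<in> glues_of tiles\<close> by (auto simp: glues_of_def)
    moreover from this obtain i l where "t = lab_tile i l" by (auto simp: tiles_def)
    ultimately show ?thesis by (auto simp: lab_tile_def)
  qed
  moreover have "\<bar>snd g\<bar> = 1" if g: "g \<in> glues_of tiles" for g
  proof -
    obtain a where "g = enc a" using coded[OF g] by blast
    thus ?thesis by (cases a) auto
  qed
  moreover have "{g \<in> glues_of tiles. snd g < 0} = {(0, - 1)}"
  proof -
    have "g = (0, -1)" if g: "g \<in> glues_of tiles" "snd g < 0" for g
    proof -
      obtain a where "g = enc a" using coded[OF g(1)] by blast
      thus ?thesis using g(2) by (cases a) auto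
    qed
    moreover have "(0, -1) \<in> glues_of tiles"
    proof -
      have "side 0 (Guard Copy) North = Some Neg" using side_Neg[of 0 "Guard Copy" North] by (simp add: rot_simps)
      hence "lab_tile 0 (Guard Copy) North = Some (0, -1)" by (simp add: lab_tile_def)
      moreover have "lab_tile 0 (Guard Copy) \<in> tiles" by (force simp: tiles_def labs_mem modes_def)
      ultimately show ?thesis unfolding glues_of_def by blast
    qed
    hence "(0, -1) \<in> {g \<in> glues_of tiles. snd g < 0}" by simp
    ultimately show ?thesis by blast
  qed
  ultimately show ?thesis by (simp add: rg_tileset_def)
qed

text \<open>Hard-coding the initial value costs a term in \<open>k * H\<close>, while segments and
  readers combine a digit only with boundedly many indices and modes. Hence no product of
  \<open>k\<close> and \<open>b\<close> occurs.\<close>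

lemma card_tiles: "card tiles \<le> 4 * ((4 * k + 3) * (H + 1) + 24 * (4 * b + 1) + 4 + 16 * b + 2)"
proof -
  have fd: "finite digits" "card digits = 4 * b"
  proof -
    have "digits = {..<b} \<times> {False, True} \<times> {False, True}" by (auto simp: digits_def)
    thus "finite digits" "card digits = 4 * b" by (simp_all add: card_cartesian_product)
  qed
  have fm: "finite modes" "card modes = 4" by (auto simp: modes_def)
  have cI: "card (insert None (Some ` digits)) \<le> 4 * b + 1"
    using fd by (metis Suc_eq_plus1 card_image_le card_insert_le_m1 diff_Suc_1 zero_less_Suc)
  have "card labs \<le> card ((\<lambda>(u, v). Seed u v) ` ({..<W} \<times> {..H}))
     + card ((\<lambda>(e, m, Do). Seg e m Do) ` ({..<(6::nat)} \<times> modes \<times> (insert None (Some ` digits))))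
     + card (Guard ` modes) + card ((\<lambda>(m, D). Reader m D) ` (modes \<times> digits)) + card {Riser, Filler}"
    unfolding labs_def by (intro order_trans[OF card_Un_le] add_mono order_refl)
  also have "\<dots> \<le> W * (H + 1) + 6 * (4 * (4 * b + 1)) + 4 + 4 * (4 * b) + 2"
  proof (intro add_mono)
    show "card ((\<lambda>(u, v). Seed u v) ` ({..<W} \<times> {..H})) \<le> W * (H + 1)"
      by (rule order_trans[OF card_image_le]) (auto simp: card_cartesian_product)
    show "card ((\<lambda>(e, m, Do). Seg e m Do) ` ({..<(6::nat)} \<times> modes \<times> (insert None (Some ` digits)))) \<le> 6 * (4 * (4 * b + 1))"
      using cI fm fd by (intro order_trans[OF card_image_le]) (auto simp: card_cartesian_product)
    show "card (Guard ` modes) \<le> 4" using card_image_le[OF fm(1), of Guard] fm by simp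
    show "card ((\<lambda>(m, D). Reader m D) ` (modes \<times> digits)) \<le> 4 * (4 * b)"
      using fm fd by (intro order_trans[OF card_image_le]) (auto simp: card_cartesian_product)
    show "card {Riser, Filler} \<le> 2" by simp
  qed
  finally have "card labs \<le> (4 * k + 3) * (H + 1) + 24 * (4 * b + 1) + 4 + 16 * b + 2" by (simp add: W_def)
  moreover have "finite labs" using fd fm by (auto simp: labs_def)
  hence "card tiles \<le> 4 * card labs" unfolding tiles_def
    by (intro order_trans[OF card_image_le]) (auto simp: card_cartesian_product)
  ultimately show ?thesis by (meson le_trans mult_le_mono2)
qed

lemma square_assembles:
  "\<exists>T p t0. t0 \<in> T \<and> rg_tileset T \<and> directed T (Map.empty(p := Some t0)) 1
     \<and> strictly_self_assembles T (Map.empty(p := Some t0)) 1 (square N)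
     \<and> card T \<le> 4 * ((4 * k + 3) * (H + 1) + 24 * (4 * b + 1) + 4 + 16 * b + 2)"
  using growth_main[OF attach_determined attach_possible] tile_of_T[OF c0_in_V] rg_tiles card_tiles
  unfolding cell_pos_image by blast

end

section \<open>Small squares\<close>

text \<open>Finitely many small squares may use one tile type per position; the tiles form a comb.\<close>

definition comb_prv :: "nat \<times> nat \<Rightarrow> nat \<times> nat" where
  "comb_prv z = (case z of (x, y) \<Rightarrow> if x > 0 then (x - 1, y) else (0, y - 1))"

definition comb_pos :: "nat \<times> nat \<Rightarrow> pos" where
  "comb_pos z = (case z of (x, y) \<Rightarrow> (int x, int y))"

text \<open>A positive glue encodes the cell that it leads to, so it occurs only on that cell and on
  its predecessor.\<close>

fun comb_tile :: "nat \<Rightarrow> nat \<times> nat \<Rightarrow> tile" where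
  "comb_tile n (x, y) West = (if x > 0 then Some (prod_encode (x, y), 1) else None)"
| "comb_tile n (x, y) South = (if x = 0 \<and> y > 0 then Some (prod_encode (x, y), 1) else None)"
| "comb_tile n (x, y) East = (if x + 1 < n then Some (prod_encode (x + 1, y), 1) else None)"
| "comb_tile n (x, y) North = (if x = 0 \<and> y + 1 < n then Some (prod_encode (0, y + 1), 1) else None)"

lemma comb_tile_SomeD:
  assumes "comb_tile n z D = Some g"
  shows "\<exists>w. g = (prod_encode w, 1) \<and> w \<noteq> (0, 0) \<and>
    (w = z \<and> comb_pos (comb_prv w) = padd (comb_pos z) (dvec D) \<or>
     comb_prv w = z \<and> comb_pos w = padd (comb_pos z) (dvec D) \<and> (z \<in> {..<n} \<times> {..<n} \<longrightarrow> w \<in> {..<n} \<times> {..<n}))"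
proof (cases z)
  case (Pair x y)
  note sm = comb_prv_def comb_pos_def padd_def
  show ?thesis
  proof (cases D)
    case North
    thus ?thesis using assms Pair by (intro exI[of _ "(0, y + 1)"]) (auto simp: sm split: if_splits)
  next
    case East
    thus ?thesis using assms Pair by (intro exI[of _ "(x + 1, y)"]) (auto simp: sm split: if_splits)
  qed (use assms Pair in \<open>auto simp: sm split: if_splits\<close>)
qed

lemma comb_link:
  assumes "z \<in> {..<n} \<times> {..<n}" "z \<noteq> (0, 0)"
  shows "\<exists>D. comb_tile n z D = Some (prod_encode z, 1) \<and> comb_tile n (comb_prv z) (opp D) = Some (prod_encode z, 1) \<and>
    comb_pos (comb_prv z) = padd (comb_pos z) (dvec D)"
proof (cases z)
  case (Pair x y)
  show ?thesis
  proof (cases "x > 0")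
    case True
    thus ?thesis using assms Pair by (intro exI[of _ West]) (auto simp: comb_prv_def comb_pos_def padd_def)
  next
    case False
    thus ?thesis using assms Pair by (intro exI[of _ South]) (auto simp: comb_prv_def comb_pos_def padd_def)
  qed
qed

lemma glue_str_pos: "glue_str g h > 0 \<Longrightarrow> \<exists>a. g = Some a \<and> h = Some a"
  by (auto simp: glue_str_def split: option.splits if_splits)

lemma square_assembles_comb:
  assumes "n \<ge> 1"
  shows "\<exists>T p t0. t0 \<in> T \<and> rg_tileset T \<and> directed T (Map.empty(p := Some t0)) 1
     \<and> strictly_self_assembles T (Map.empty(p := Some t0)) 1 (square n) \<and> card T \<le> n * n + 1"
proof -
  let ?V = "{..<n} \<times> {..<n}"
  txt \<open>A tile without positive glue never attaches; it only supplies the mandatory negative glue.\<close>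
  define dud :: tile where "dud d = (if d = North then Some (0, -1) else None)" for d
  define T where "T = insert dud (comb_tile n ` ?V)"
  let ?r = "{(c, d). fst c + snd c < fst d + snd d} :: ((nat \<times> nat) \<times> (nat \<times> nat)) set"
  interpret growth ?V comb_pos "comb_tile n" comb_prv "(0, 0)" T ?r
  proof
    show "inj_on comb_pos ?V" by (auto simp: inj_on_def comb_pos_def)
    show "wf ?r" using wf_measure[of "\<lambda>c :: nat \<times> nat. fst c + snd c"] by (simp add: measure_def inv_image_def less_than_iff)
    show "(comb_prv c, c) \<in> ?r" if "c \<in> ?V" "c \<noteq> (0, 0)" for c
      using that by (cases c) (auto simp: comb_prv_def)
    show "comb_prv c \<in> ?V" if "c \<in> ?V" for c
      using that by (cases c) (auto simp: comb_prv_def)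
  qed (use assms in \<open>auto simp: T_def\<close>)
  let ?D = "down_closed ?V comb_prv (0, 0)"
  have strength: "glue_str (comb_tile n z D) h \<ge> 0" for z D h
    using comb_tile_SomeD[of n z D] by (cases "comb_tile n z D") (auto simp: glue_str_def)
  have attach: "\<exists>c\<in>?V. comb_pos c = x \<and> comb_tile n c = t \<and> comb_prv c \<in> A"
    if A: "?D A" and x: "x \<notin> comb_pos ` A" and t: "t \<in> T" and bs: "bind_strength (asm A) x t \<ge> 1" for A x t
  proof -
    have AV: "A \<subseteq> ?V" using A by (simp add: down_closed_def)
    define f where "f D = (case asm A (padd x (dvec D)) of None \<Rightarrow> 0 | Some t' \<Rightarrow> glue_str (t D) (t' (opp D)))" for D
    have "(\<Sum>D\<in>{North, East, South, West}. f D) \<ge> 1" using bs by (simp add: f_def bind_strength_def)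
    then obtain D where D: "f D > 0" using sum_dirs_pos by blast
    then obtain t' where t': "asm A (padd x (dvec D)) = Some t'" "glue_str (t D) (t' (opp D)) > 0"
      by (auto simp: f_def split: option.splits)
    then obtain c where c: "c \<in> A" "padd x (dvec D) = comb_pos c" "t' = comb_tile n c"
      using asm_SomeD[OF AV] by metis
    obtain g where g: "t D = Some g" "comb_tile n c (opp D) = Some g"
      using glue_str_pos[OF t'(2)] c(3) by auto
    have xc: "x = padd (comb_pos c) (dvec (opp D))" using c(2) by (metis padd_opp(1))
    obtain w where w: "g = (prod_encode w, 1)" "w \<noteq> (0, 0)"
      "w = c \<and> comb_pos (comb_prv w) = x \<or> comb_prv w = c \<and> comb_pos w = x \<and> (c \<in> ?V \<longrightarrow> w \<in> ?V)"
      using comb_tile_SomeD[OF g(2)] xc by auto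
    have "w \<noteq> c"
    proof
      assume wc: "w = c"
      hence "comb_prv w \<in> A" using A c(1) w(2) by (auto simp: down_closed_def)
      moreover have "comb_pos (comb_prv w) = x"
      proof (rule ccontr)
        assume "comb_pos (comb_prv w) \<noteq> x"
        hence "comb_prv c = c" using w(3) wc by auto
        thus False using w(2) wc by (cases c) (auto simp: comb_prv_def split: if_splits)
      qed
      ultimately show False using x by blast
    qed
    hence w': "comb_prv w = c" "comb_pos w = x" "w \<in> ?V" using w(3) c(1) AV by auto
    have "t \<noteq> dud" using g(1) w(1) by (auto simp: dud_def split: if_splits)
    then obtain z where z: "z \<in> ?V" "t = comb_tile n z" using t by (auto simp: T_def)
    from comb_tile_SomeD[of n z D g] g(1) z(2) w(1)
    have "w = z \<or> comb_prv w = z \<and> comb_pos w = padd (comb_pos z) (dvec D)" by auto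
    \<comment> \<open>\<open>w\<close> lies on side \<open>opp D\<close> of \<open>c\<close>, so the
      glue found on side \<open>D\<close> of \<open>t\<close> rules out a second copy of the tile of
      \<open>c\<close>.\<close>
    moreover have "comb_pos w \<noteq> padd (comb_pos c) (dvec D)"
      unfolding w'(2) xc by (cases D) (auto simp: padd_def)
    ultimately have "w = z" using w'(1) by auto
    thus ?thesis using w' z c(1) by (intro bexI[of _ w]) auto
  qed
  have progress: "bind_strength (asm A) (comb_pos c) (comb_tile n c) \<ge> 1"
    if A: "?D A" and c: "c \<in> ?V" "c \<notin> A" "comb_prv c \<in> A" for A c
  proof -
    have AV: "A \<subseteq> ?V" using A by (simp add: down_closed_def)
    define f where "f D = (case asm A (padd (comb_pos c) (dvec D)) of None \<Rightarrow> 0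
      | Some t' \<Rightarrow> glue_str (comb_tile n c D) (t' (opp D)))" for D
    have "c \<noteq> (0, 0)" using A c(2) by (auto simp: down_closed_def)
    then obtain D where D: "comb_tile n c D = Some (prod_encode c, 1)"
      "comb_tile n (comb_prv c) (opp D) = Some (prod_encode c, 1)"
      "comb_pos (comb_prv c) = padd (comb_pos c) (dvec D)" using comb_link c(1) by blast
    have "asm A (padd (comb_pos c) (dvec D)) = Some (comb_tile n (comb_prv c))"
      using asm_pos[OF AV, of "comb_prv c"] c(3) AV D(3) by auto
    hence "f D = 1" using D by (simp add: f_def glue_str_def)
    moreover have "f D \<ge> 0" for D using strength by (auto simp: f_def split: option.splits)
    ultimately have "(\<Sum>D\<in>{North, East, South, West}. f D) \<ge> 1" by (intro sum_dirs_ge[of f D]) auto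
    thus ?thesis by (simp add: f_def bind_strength_def)
  qed
  have img: "comb_pos ` ?V = square n"
  proof (intro subset_antisym subsetI)
    fix z assume "z \<in> square n"
    hence "z = comb_pos (nat (fst z), nat (snd z))" "(nat (fst z), nat (snd z)) \<in> ?V"
      by (auto simp: square_def comb_pos_def)
    thus "z \<in> comb_pos ` ?V" by blast
  qed (auto simp: square_def comb_pos_def)
  have gl: "g = (0, -1) \<or> snd g = 1" if g: "g \<in> glues_of T" for g
  proof -
    obtain t d where t: "t \<in> T" "t d = Some g" using g by (auto simp: glues_of_def)
    show ?thesis
    proof (cases "t = dud")
      case True
      thus ?thesis using t by (auto simp: dud_def split: if_splits)
    next
      case False
      then obtain z where "t = comb_tile n z" using t by (auto simp: T_def)
      thus ?thesis using comb_tile_SomeD[of n z d g] t by auto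
    qed
  qed
  have "(0, -1) \<in> glues_of T" unfolding glues_of_def T_def by (auto simp: dud_def)
  hence "(0, -1) \<in> {g \<in> glues_of T. snd g < 0}" by simp
  hence "{g \<in> glues_of T. snd g < 0} = {(0, -1)}" using gl by force
  moreover have "\<bar>snd g\<bar> = 1" if "g \<in> glues_of T" for g using gl[OF that] by auto
  ultimately have "rg_tileset T" by (simp add: rg_tileset_def T_def)
  moreover have "card T \<le> n * n + 1"
    using card_insert_le_m1[of "n * n + 1" "comb_tile n ` ?V" dud] card_image_le[of ?V "comb_tile n"]
    by (simp add: T_def card_cartesian_product)
  moreover have "comb_tile n (0, 0) \<in> T" using assms by (auto simp: T_def)
  ultimately show ?thesis using growth_main[OF attach progress] unfolding img by blast
qed

section \<open>The number of tile types\<close>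

text \<open>From \<open>ln x \<le> x - 1\<close> and \<open>ln 2 \<ge> 1 / 2\<close>; the factor 2
  replaces the exact value of \<open>1 / ln 2\<close>.\<close>

lemma log_le_linear:
  assumes "x > (0::real)"
  shows "log 2 x \<le> 2 * x"
proof -
  have "ln (1 / 2 :: real) \<le> 1 / 2 - 1" by (intro ln_le_minus_one) simp
  hence l2: "ln 2 \<ge> (1 / 2 :: real)" by (simp add: ln_div)
  have "ln x \<le> x * 1" using ln_le_minus_one[OF assms] by simp
  also have "\<dots> \<le> x * (2 * ln 2)" using l2 assms by (intro mult_left_mono) auto
  finally show ?thesis by (simp add: log_def divide_le_eq mult_ac)
qed

lemma log_le_sqrt:
  assumes "x > (0::real)"
  shows "log 2 x \<le> 4 * sqrt x"
proof -
  have "log 2 x = log 2 (sqrt x ^ 2)" using assms by simp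
  also have "\<dots> = 2 * log 2 (sqrt x)" by (subst log_nat_power) (use assms in auto)
  also have "\<dots> \<le> 2 * (2 * sqrt x)" using log_le_linear[of "sqrt x"] assms by simp
  finally show ?thesis by simp
qed

section \<open>Choice of the counter parameters\<close>

lemma square_assembles_counter:
  fixes n b k :: nat
  assumes "2 \<le> b" "1 \<le> k" "n \<le> b ^ k" "8 * k + 8 \<le> n"
  shows "\<exists>T p t0. t0 \<in> T \<and> rg_tileset T \<and> directed T (Map.empty(p := Some t0)) 1
     \<and> strictly_self_assembles T (Map.empty(p := Some t0)) 1 (square n)
     \<and> card T \<le> 80 * k + 448 * b + 180"
proof -
  \<comment> \<open>Each increment takes two passes of two rows, so a strip can be tuned only in
    steps of 4; \<open>H\<close>, between 1 and 4, absorbs the remainder.\<close>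
  define R where "R = (n - 4 * k - 4) div 4"
  define H where "H = (n - 4 * k - 4) mod 4 + 1"
  have n: "n = H + 4 * R + (4 * k + 3)" using assms(4) by (simp add: R_def H_def)
  have H: "1 \<le> H" "H \<le> 4" by (auto simp: H_def)
  have R: "k + 1 \<le> R" using n assms(4) H by linarith
  have "(4 * k + 3) * (H + 1) \<le> (4 * k + 3) * 5" using H(2) by (intro mult_le_mono2) simp
  then obtain X where X: "(4 * k + 3) * (H + 1) = X" "X \<le> 20 * k + 15" by simp
  have "R \<le> b ^ k" using n assms(3) by linarith
  then interpret strips b k R H using assms(1,2) H(1) R by unfold_locales
  have Nn: "N = n" by (simp add: N_def M_def W_def n)
  have bound: "4 * ((4 * k + 3) * (H + 1) + 24 * (4 * b + 1) + 4 + 16 * b + 2) \<le> 80 * k + 448 * b + 180"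
    unfolding X(1) using X(2) by simp
  obtain T p t0 where "t0 \<in> T" "rg_tileset T" "directed T (Map.empty(p := Some t0)) 1"
    "strictly_self_assembles T (Map.empty(p := Some t0)) 1 (square n)"
    "card T \<le> 4 * ((4 * k + 3) * (H + 1) + 24 * (4 * b + 1) + 4 + 16 * b + 2)"
    using square_assembles unfolding Nn by blast
  thus ?thesis using le_trans[OF _ bound] by blast
qed

lemma square_large:
  fixes n :: nat
  assumes n: "n \<ge> 2 ^ 16"
  shows "\<exists>T p t0. t0 \<in> T \<and> rg_tileset T \<and> directed T (Map.empty(p := Some t0)) 1
     \<and> strictly_self_assembles T (Map.empty(p := Some t0)) 1 (square n)
     \<and> real (card T) \<le> 3368 * (log 2 n / log 2 (log 2 n))"
proof -
  define l where "l = log 2 (real n)"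
  define ll where "ll = log 2 l"
  define k where "k = nat \<lceil>2 * l / ll\<rceil>"
  define b where "b = nat \<lceil>sqrt l\<rceil>"
  have nr: "real n \<ge> 2 ^ 16" using n by simp
  have "16 = log 2 ((2::real) ^ 16)" by (subst log_nat_power) auto
  also have "\<dots> \<le> l" unfolding l_def using nr by (subst log_le_cancel_iff) auto
  finally have l16: "l \<ge> 16" .
  have "4 = log 2 ((2::real) ^ 4)" by (subst log_nat_power) auto
  also have "\<dots> \<le> ll" unfolding ll_def using l16 by (subst log_le_cancel_iff) auto
  finally have ll4: "ll \<ge> 4" .
  have half: "1 / 2 \<le> l / ll"
    using log_le_linear[of l] l16 ll4 by (simp add: ll_def field_simps)
  \<comment> \<open>This keeps the base \<open>b\<close> within a constant factor of
    \<open>l / ll\<close>, the order of \<open>k\<close>.\<close>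
  have sq: "sqrt l \<le> 4 * (l / ll)"
  proof -
    have "ll \<le> 4 * sqrt l" using log_le_sqrt[of l] l16 by (simp add: ll_def)
    hence "sqrt l * ll \<le> sqrt l * (4 * sqrt l)" using l16 by (intro mult_left_mono) auto
    also have "\<dots> = 4 * l" using l16 by simp
    finally show ?thesis using ll4 by (simp add: field_simps)
  qed
  have k1: "real k \<le> 2 * (l / ll) + 1" "real k \<ge> 2 * l / ll"
    using half unfolding k_def by linarith+
  have "sqrt l \<ge> sqrt (4 ^ 2)" using l16 by (intro real_sqrt_le_mono) simp
  hence sl: "sqrt l \<ge> 4" by simp
  have b1: "real b \<le> sqrt l + 1" "real b \<ge> sqrt l" using sl unfolding b_def by linarith+
  have "b \<ge> 2" using b1 sl by linarith
  moreover have "k \<ge> 1" using k1 half by linarith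
  \<comment> \<open>Since \<open>sqrt l\<close> is \<open>2 powr (ll / 2)\<close>, raising it to the
    power \<open>2 * l / ll\<close> gives exactly \<open>2 powr l = n\<close>.\<close>
  moreover have "n \<le> b ^ k"
  proof -
    have "real n = 2 powr l" using nr by (simp add: l_def)
    also have "\<dots> = (2 powr ll) powr (1 / 2 * (2 * l / ll))" using ll4 by (simp add: powr_powr)
    also have "\<dots> = sqrt l powr (2 * l / ll)" using l16 by (simp add: ll_def powr_half_sqrt[symmetric] powr_powr)
    also have "\<dots> \<le> sqrt l powr real k" using k1 sl l16 by (intro powr_mono) auto
    also have "\<dots> = sqrt l ^ k" by (rule powr_realpow) (use sl in linarith)
    also have "\<dots> \<le> real b ^ k" using b1 sl l16 by (intro power_mono) auto
    finally show ?thesis by (metis of_nat_le_iff of_nat_power)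
  qed
  moreover have "8 * k + 8 \<le> n"
  proof -
    have "l / ll \<le> l / 4" using ll4 l16 by (intro divide_left_mono) auto
    hence "real k \<le> l / 2 + 1" using k1(1) by linarith
    moreover have "l \<le> 4 * sqrt n" unfolding l_def using nr by (intro log_le_sqrt) simp
    moreover have "32 * sqrt n \<le> n"
    proof -
      have "sqrt (256 ^ 2) \<le> sqrt n" using nr by (intro real_sqrt_le_mono) simp
      hence "32 * sqrt n \<le> sqrt n * sqrt n" by (intro mult_right_mono) auto
      thus ?thesis by simp
    qed
    ultimately have "8 * real k + 8 \<le> real n" using nr l16 by simp
    thus ?thesis by linarith
  qed
  ultimately obtain T p t0 where T: "t0 \<in> T \<and> rg_tileset T \<and> directed T (Map.empty(p := Some t0)) 1
     \<and> strictly_self_assembles T (Map.empty(p := Some t0)) 1 (square n)" "card T \<le> 80 * k + 448 * b + 180"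
    using square_assembles_counter by blast
  have "real (card T) \<le> 80 * real k + 448 * real b + 180" using T(2) by linarith
  \<comment> \<open>The terms in \<open>l / ll\<close> give \<open>160 + 1792 = 1952\<close>; the
    constants sum to 708, at most \<open>1416 * (l / ll)\<close> by \<open>half\<close>.\<close>
  also have "\<dots> \<le> 3368 * (l / ll)" using k1 b1 sq half by linarith
  finally show ?thesis using T(1) unfolding ll_def l_def by blast
qed

text \<open>At \<open>N = 2\<close> the denominator \<open>log 2 (log 2 N)\<close> is 0 and the
  quotient is 0 by the convention for division, so the size bound is stated from
  \<open>N = 3\<close> on.\<close>

theorem theorem1:
  shows "\<exists>C::real. \<forall>N::nat. N \<ge> 2 \<longrightarrow>
           (\<exists>T p t0. t0 \<in> T \<and> rg_tileset T
              \<and> directed T (Map.empty(p := Some t0)) 1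
              \<and> strictly_self_assembles T (Map.empty(p := Some t0)) 1 (square N)
              \<and> (N \<ge> 3 \<longrightarrow> real (card T) \<le> C * log 2 (real N) / log 2 (log 2 (real N))))"
proof (intro exI[of _ "2 ^ 34"] allI impI)
  fix N :: nat
  assume N2: "N \<ge> 2"
  define r where "r = log 2 (real N) / log 2 (log 2 (real N))"
  have r: "r \<ge> 1 / 2" if "N \<ge> 3"
  proof -
    have "log 2 (real N) > log 2 2" using that by (subst log_less_cancel_iff) auto
    hence l: "log 2 (real N) > 1" by simp
    hence "log 2 (log 2 (real N)) > 0" by simp
    thus ?thesis using log_le_linear[of "log 2 (real N)"] l by (simp add: r_def field_simps)
  qed
  show "\<exists>T p t0. t0 \<in> T \<and> rg_tileset T
              \<and> directed T (Map.empty(p := Some t0)) 1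
              \<and> strictly_self_assembles T (Map.empty(p := Some t0)) 1 (square N)
              \<and> (N \<ge> 3 \<longrightarrow> real (card T) \<le> 2 ^ 34 * log 2 (real N) / log 2 (log 2 (real N)))"
  proof (cases "N \<ge> 2 ^ 16")
    case True
    then obtain T p t0 where T: "t0 \<in> T" "rg_tileset T" "directed T (Map.empty(p := Some t0)) 1"
      "strictly_self_assembles T (Map.empty(p := Some t0)) 1 (square N)" "real (card T) \<le> 3368 * r"
      using square_large unfolding r_def by blast
    have "N \<ge> 3" using True by simp
    hence "3368 * r \<le> 2 ^ 34 * r" using r by (intro mult_right_mono) auto
    hence "real (card T) \<le> 2 ^ 34 * log 2 (real N) / log 2 (log 2 (real N))"
      using T(5) by (simp add: r_def)
    thus ?thesis using T by blast
  next
    case False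
    obtain T p t0 where T: "t0 \<in> T" "rg_tileset T" "directed T (Map.empty(p := Some t0)) 1"
      "strictly_self_assembles T (Map.empty(p := Some t0)) 1 (square N)" "card T \<le> N * N + 1"
      using square_assembles_comb[of N] N2 by auto
    have "N * N \<le> 2 ^ 16 * 2 ^ 16" using False by (intro mult_mono) auto
    hence "card T \<le> 2 ^ 32 + 1" using T(5) by simp
    hence "real (card T) \<le> 2 ^ 32 + 1" by simp
    \<comment> \<open>As \<open>r\<close> is at least \<open>1 / 2\<close>, the constant leaves
      \<open>2 ^ 33\<close>, enough for one tile type per position and the extra tile.\<close>
    hence "real (card T) \<le> 2 ^ 34 * r" if "N \<ge> 3" using r[OF that] by simp
    hence "N \<ge> 3 \<longrightarrow> real (card T) \<le> 2 ^ 34 * log 2 (real N) / log 2 (log 2 (real N))"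
      by (simp add: r_def)
    thus ?thesis using T by blast
  qed
qed

end
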